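(* Let $d,n$ be positive integers. If the variety $N(d,m)$ is irreducible for each positive integer $m\le n$, then the variety $C(d,n)$ is also irreducible.
   Context: $\mathbb{F}$ is an algebraically closed field of arbitrary characteristic. $C(d,n)\subseteq M_n(\mathbb{F})^d$ is the set of all $d$-tuples of pairwise commuting $n\times n$ matrices over $\mathbb{F}$, and $N(d,n)\subseteq C(d,n)$ is the subset of $d$-tuples of pairwise commuting nilpotent matrices. Both are affine varieties (Zariski closed subsets of $\mathbb{F}^{dn^2}$), and irreducibility is with respect to the Zariski topology. *)

theory Defs
  imports
    "HOL-Analysis.Abstract_Topology"
    "HOL-Library.Poly_Mapping"
    "HOL-Computational_Algebra.Polynomial"
    "Jordan_Normal_Form.Matrix"
begin

section \<open>Multivariate polynomials\<close>

text \<open>A polynomial is a finitely supported map from monomials to coefficients; a monomial is a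
  finitely supported map from variables to exponents.\<close>

type_synonym ('v, 'a) mpolynomial = "('v \<Rightarrow>\<^sub>0 nat) \<Rightarrow>\<^sub>0 'a"

definition mpolys_in :: "'v set \<Rightarrow> ('v, 'a::zero) mpolynomial set" where
  "mpolys_in V = {p. \<forall>m\<in>Poly_Mapping.keys p. Poly_Mapping.keys m \<subseteq> V}"

definition monom_eval :: "('v \<Rightarrow>\<^sub>0 nat) \<Rightarrow> ('v \<Rightarrow> 'a::comm_semiring_1) \<Rightarrow> 'a" where
  "monom_eval m x = (\<Prod>v\<in>Poly_Mapping.keys m. x v ^ Poly_Mapping.lookup m v)"

definition mpoly_eval :: "('v, 'a::comm_semiring_1) mpolynomial \<Rightarrow> ('v \<Rightarrow> 'a) \<Rightarrow> 'a" where
  "mpoly_eval p x = (\<Sum>m\<in>Poly_Mapping.keys p. Poly_Mapping.lookup p m * monom_eval m x)"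

lemma monom_eval_superset:
  assumes "finite V" "Poly_Mapping.keys m \<subseteq> V"
  shows "monom_eval m x = (\<Prod>v\<in>V. x v ^ Poly_Mapping.lookup m v)"
  unfolding monom_eval_def
  by (rule prod.mono_neutral_left) (use assms in \<open>auto simp: in_keys_iff\<close>)

lemma monom_eval_add: "monom_eval (m + m') x = monom_eval m x * monom_eval m' x"
proof -
  let ?V = "Poly_Mapping.keys m \<union> Poly_Mapping.keys m'"
  have "Poly_Mapping.keys (m + m') \<subseteq> ?V"
    by (rule Poly_Mapping.keys_add)
  then show ?thesis
    by (simp add: monom_eval_superset[of ?V] lookup_add power_add prod.distrib)
qed

lemma mpoly_eval_superset:
  assumes "finite M" "Poly_Mapping.keys p \<subseteq> M"
  shows "mpoly_eval p x = (\<Sum>m\<in>M. Poly_Mapping.lookup p m * monom_eval m x)"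
  unfolding mpoly_eval_def
  by (rule sum.mono_neutral_left) (use assms in \<open>auto simp: in_keys_iff\<close>)

lemma mpoly_eval_0 [simp]: "mpoly_eval 0 x = 0"
  by (simp add: mpoly_eval_def)

lemma mpoly_eval_single: "mpoly_eval (Poly_Mapping.single m c) x = c * monom_eval m x"
  by (subst mpoly_eval_superset[of "{m}"]) auto

lemma mpoly_eval_add: "mpoly_eval (p + q) x = mpoly_eval p x + mpoly_eval q x"
proof -
  let ?M = "Poly_Mapping.keys p \<union> Poly_Mapping.keys q"
  have "Poly_Mapping.keys (p + q) \<subseteq> ?M"
    by (rule Poly_Mapping.keys_add)
  then show ?thesis
    by (simp add: mpoly_eval_superset[of ?M] lookup_add distrib_right sum.distrib)
qed

lemma mpoly_eval_sum: "mpoly_eval (\<Sum>i\<in>I. f i) x = (\<Sum>i\<in>I. mpoly_eval (f i) x)"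
  by (induction I rule: infinite_finite_induct) (auto simp: mpoly_eval_add)

lemma mpolynomial_expansion:
  fixes p :: "('v, 'a::comm_semiring_1) mpolynomial"
  shows "p = (\<Sum>m\<in>Poly_Mapping.keys p. Poly_Mapping.single m (Poly_Mapping.lookup p m))"
  by (rule poly_mapping_eqI)
     (auto simp: lookup_sum lookup_single when_def in_keys_iff)

lemma mpoly_eval_mult: "mpoly_eval (p * q) x = mpoly_eval p x * mpoly_eval q x"
proof -
  let ?p = "\<lambda>m. Poly_Mapping.lookup p m" and ?q = "\<lambda>m. Poly_Mapping.lookup q m"
  have "p * q = (\<Sum>m\<in>Poly_Mapping.keys p. Poly_Mapping.single m (?p m)) *
                (\<Sum>m\<in>Poly_Mapping.keys q. Poly_Mapping.single m (?q m))"
    by (metis mpolynomial_expansion)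
  also have "\<dots> = (\<Sum>m\<in>Poly_Mapping.keys p. \<Sum>m'\<in>Poly_Mapping.keys q.
                Poly_Mapping.single (m + m') (?p m * ?q m'))"
    by (simp add: sum_product mult_single)
  finally have "mpoly_eval (p * q) x = (\<Sum>m\<in>Poly_Mapping.keys p. \<Sum>m'\<in>Poly_Mapping.keys q.
                (?p m * monom_eval m x) * (?q m' * monom_eval m' x))"
    by (simp add: mpoly_eval_sum mpoly_eval_single monom_eval_add mult_ac)
  then show ?thesis
    by (simp add: mpoly_eval_def sum_product)
qed

lemma mpolys_in_mult:
  assumes "p \<in> mpolys_in V" "q \<in> mpolys_in V"
  shows "p * q \<in> mpolys_in V"
  unfolding mpolys_in_def
proof safe
  fix m v assume "m \<in> Poly_Mapping.keys (p * q)" and v: "v \<in> Poly_Mapping.keys m"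
  then obtain a b where "m = a + b" "a \<in> Poly_Mapping.keys p" "b \<in> Poly_Mapping.keys q"
    using keys_mult[of p q] by blast
  with v show "v \<in> V"
    using assms Poly_Mapping.keys_add[of a b] unfolding mpolys_in_def by blast
qed


section \<open>The Zariski topology on tuples of matrices\<close>

definition mat_tuples :: "nat \<Rightarrow> nat \<Rightarrow> 'a mat list set" where
  "mat_tuples d n = {As. length As = d \<and> set As \<subseteq> carrier_mat n n}"

text \<open>The variable \<open>(k, i, j)\<close> stands for entry \<open>(i, j)\<close> of the \<open>k\<close>-th matrix.\<close>

definition entry_vars :: "nat \<Rightarrow> nat \<Rightarrow> (nat \<times> nat \<times> nat) set" where
  "entry_vars d n = {..<d} \<times> {..<n} \<times> {..<n}"

definition entries :: "'a mat list \<Rightarrow> nat \<times> nat \<times> nat \<Rightarrow> 'a" where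
  "entries As = (\<lambda>(k, i, j). (As ! k) $$ (i, j))"

definition zero_locus ::
  "nat \<Rightarrow> nat \<Rightarrow> (nat \<times> nat \<times> nat, 'a::comm_semiring_1) mpolynomial set \<Rightarrow> 'a mat list set" where
  "zero_locus d n P = {As \<in> mat_tuples d n. \<forall>p\<in>P. mpoly_eval p (entries As) = 0}"

definition zariski_topology :: "nat \<Rightarrow> nat \<Rightarrow> 'a::idom mat list topology" where
  "zariski_topology d n = topology (\<lambda>U. \<exists>P \<subseteq> mpolys_in (entry_vars d n).
     U = mat_tuples d n - zero_locus d n P)"

lemma zero_locus_Un:
  fixes P Q :: "(nat \<times> nat \<times> nat, 'a::idom) mpolynomial set"
  shows "zero_locus d n P \<union> zero_locus d n Q = zero_locus d n {p * q | p q. p \<in> P \<and> q \<in> Q}"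
proof safe
  fix As assume "As \<in> zero_locus d n {p * q | p q. p \<in> P \<and> q \<in> Q}" "As \<notin> zero_locus d n Q"
  then obtain q where As: "As \<in> mat_tuples d n" and q: "q \<in> Q" "mpoly_eval q (entries As) \<noteq> 0"
    and *: "\<And>p. p \<in> P \<Longrightarrow> mpoly_eval (p * q) (entries As) = 0"
    by (auto simp: zero_locus_def)
  with * show "As \<in> zero_locus d n P"
    by (auto simp: zero_locus_def mpoly_eval_mult)
qed (auto simp: zero_locus_def mpoly_eval_mult)

lemma istopology_zariski:
  "istopology (\<lambda>U. \<exists>P \<subseteq> mpolys_in (entry_vars d n).
     U = mat_tuples d n - zero_locus d n (P :: (nat \<times> nat \<times> nat, 'a::idom) mpolynomial set))"
  (is "istopology ?L")
  unfolding istopology_def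
proof (intro conjI allI impI)
  fix S T assume "?L S" "?L T"
  then obtain P Q where PQ: "P \<subseteq> mpolys_in (entry_vars d n)" "Q \<subseteq> mpolys_in (entry_vars d n)"
    "S = mat_tuples d n - zero_locus d n P" "T = mat_tuples d n - zero_locus d n Q"
    by blast
  let ?R = "{p * q | p q. p \<in> P \<and> q \<in> Q}"
  have "?R \<subseteq> mpolys_in (entry_vars d n)"
    using PQ(1,2) by (auto intro: mpolys_in_mult)
  moreover have "S \<inter> T = mat_tuples d n - zero_locus d n ?R"
    using PQ(3,4) zero_locus_Un[of d n P Q] by blast
  ultimately show "?L (S \<inter> T)" by blast
next
  fix K assume "\<forall>U\<in>K. ?L U"
  then obtain P where P: "\<And>U. U \<in> K \<Longrightarrow> P U \<subseteq> mpolys_in (entry_vars d n) \<and>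
      U = mat_tuples d n - zero_locus d n (P U)"
    by metis
  have eq: "\<Union>K = (\<Union>U\<in>K. mat_tuples d n - zero_locus d n (P U))"
    using P by blast
  have "\<Union>K = mat_tuples d n - zero_locus d n (\<Union>U\<in>K. P U)"
    unfolding eq by (auto simp: zero_locus_def)
  moreover have "(\<Union>U\<in>K. P U) \<subseteq> mpolys_in (entry_vars d n)"
    using P by blast
  ultimately show "?L (\<Union>K)" by blast
qed

lemma openin_zariski_topology:
  "openin (zariski_topology d n) U \<longleftrightarrow>
     (\<exists>P \<subseteq> mpolys_in (entry_vars d n). U = mat_tuples d n - zero_locus d n P)"
  unfolding zariski_topology_def topology_inverse'[OF istopology_zariski] ..

lemma topspace_zariski_topology [simp]:
  "topspace (zariski_topology d n :: 'a::idom mat list topology) = mat_tuples d n"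
proof
  show "topspace (zariski_topology d n :: 'a mat list topology) \<subseteq> mat_tuples d n"
    unfolding topspace_def openin_zariski_topology by blast
  let ?one = "Poly_Mapping.single 0 1 :: (nat \<times> nat \<times> nat, 'a) mpolynomial"
  have "openin (zariski_topology d n) (mat_tuples d n :: 'a mat list set)"
    unfolding openin_zariski_topology
    by (rule exI[of _ "{?one}"])
       (auto simp: mpolys_in_def zero_locus_def mpoly_eval_single monom_eval_def simp del: single_one)
  then show "mat_tuples d n \<subseteq> topspace (zariski_topology d n :: 'a mat list topology)"
    by (rule openin_subset)
qed

lemma closedin_zariski_topology:
  "closedin (zariski_topology d n) Z \<longleftrightarrow>
     (\<exists>P \<subseteq> mpolys_in (entry_vars d n). Z = zero_locus d n P)"
proof -
  have sub: "zero_locus d n P \<subseteq> mat_tuples d n"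
    for P :: "(nat \<times> nat \<times> nat, 'a) mpolynomial set"
    by (auto simp: zero_locus_def)
  show ?thesis
    unfolding closedin_def openin_zariski_topology topspace_zariski_topology
    using sub by blast
qed

definition irreducible_space :: "'a topology \<Rightarrow> bool" where
  "irreducible_space X \<longleftrightarrow> topspace X \<noteq> {} \<and>
     (\<forall>Y Z. closedin X Y \<and> closedin X Z \<and> topspace X = Y \<union> Z \<longrightarrow> topspace X = Y \<or> topspace X = Z)"

definition zariski_irreducible :: "nat \<Rightarrow> nat \<Rightarrow> 'a::idom mat list set \<Rightarrow> bool" where
  "zariski_irreducible d n S \<longleftrightarrow> irreducible_space (subtopology (zariski_topology d n) S)"


section \<open>Commuting varieties\<close>

definition nilpotent_mat :: "'a::semiring_1 mat \<Rightarrow> bool" where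
  "nilpotent_mat A \<longleftrightarrow> square_mat A \<and> (\<exists>k. A ^\<^sub>m k = 0\<^sub>m (dim_row A) (dim_row A))"

definition commuting_variety :: "nat \<Rightarrow> nat \<Rightarrow> 'a::semiring_1 mat list set" where
  "commuting_variety d n = {As \<in> mat_tuples d n. \<forall>A\<in>set As. \<forall>B\<in>set As. A * B = B * A}"

definition nilpotent_commuting_variety :: "nat \<Rightarrow> nat \<Rightarrow> 'a::semiring_1 mat list set" where
  "nilpotent_commuting_variety d n = {As \<in> commuting_variety d n. \<forall>A\<in>set As. nilpotent_mat A}"

end

(*
  Let R be the set of tuples (p_1(X), ..., p_d(X)) with X an n x n matrix and p_i polynomials.  Any two
  points of R are joined inside R by a curve with polynomial entries, so R is irreducible, and it
  suffices to show that R is dense in C(d,n).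

  A nilpotent commuting tuple whose first matrix A satisfies A^(m-1) \<noteq> 0 lies in R, since every matrix
  commuting with A is then a polynomial in A.  These tuples form a nonempty open subset of N(d,m), so
  irreducibility puts all of N(d,m) in the closure of R, and by translation also every tuple whose
  members have a single eigenvalue each.  In any other commuting tuple some member has a nontrivial
  idempotent E among its polynomials; E commutes with the whole tuple and splits it into two smaller
  blocks, so induction on the size applies: a direct sum of tuples in R is again in R by the Chinese
  remainder theorem.
*)

theory Submission
  imports Defs "Jordan_Normal_Form.Jordan_Normal_Form"
begin

text \<open>The degrees in R are unbounded, so R is not presented as the image of one affine space;
  curves through two given points replace such a parametrization. They are straight lines in the
  parameters (X, p_1, ..., p_d), since the segment between two points of R need not stay in R.
  Irreducibility is used as primality of the vanishing ideal: if a product of two polynomials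
  vanishes on the set, one factor does. Density then means that a polynomial vanishing on R vanishes
  on C(d,n). Scalar translation and the formation of block sums are regular maps that preserve R,
  hence also its closure; this is what lets the induction work with points of the closure only. The
  idempotent enters through a factorization E = U V with V U = 1, and likewise 1 - E = U' V'. These
  matrices act as inclusions and projections for the two summands, so no basis or simultaneous
  triangular form is ever chosen.\<close>

section \<open>Polynomials evaluated at a matrix\<close>

text \<open>The sum is formed entry by entry because matrices of all sizes share one type and so
  have no common zero to start a sum of matrices from.\<close>

definition poly_mat :: "'a::comm_ring_1 poly \<Rightarrow> 'a mat \<Rightarrow> 'a mat" where
  "poly_mat p A = mat (dim_row A) (dim_row A) (\<lambda>(i, j). \<Sum>k\<le>degree p. coeff p k * (A ^\<^sub>m k) $$ (i, j))"

lemma poly_mat_carrier [simp, intro]: "A \<in> carrier_mat n n \<Longrightarrow> poly_mat p A \<in> carrier_mat n n"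
  by (auto simp: poly_mat_def)

lemma poly_mat_dim [simp]:
  "dim_row (poly_mat p A) = dim_row A" "dim_col (poly_mat p A) = dim_row A"
  by (auto simp: poly_mat_def)

text \<open>Any bound above the degree may be used, so that polynomials of different degrees can be
  compared over one index range.\<close>

lemma poly_mat_index:
  assumes "A \<in> carrier_mat n n" "i < n" "j < n" "degree p \<le> N"
  shows "poly_mat p A $$ (i, j) = (\<Sum>k\<le>N. coeff p k * (A ^\<^sub>m k) $$ (i, j))"
proof -
  have "poly_mat p A $$ (i, j) = (\<Sum>k\<le>degree p. coeff p k * (A ^\<^sub>m k) $$ (i, j))"
    using assms by (auto simp: poly_mat_def)
  also have "\<dots> = (\<Sum>k\<le>N. coeff p k * (A ^\<^sub>m k) $$ (i, j))"
    by (rule sum.mono_neutral_left) (use assms in \<open>auto simp: coeff_eq_0\<close>)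
  finally show ?thesis .
qed

lemma poly_mat_0 [simp]: "A \<in> carrier_mat n n \<Longrightarrow> poly_mat 0 A = 0\<^sub>m n n"
  by (rule eq_matI) (auto simp: poly_mat_def)

lemma index_mult_mat_sum:
  "(A :: 'a::semiring_0 mat) \<in> carrier_mat n k \<Longrightarrow> B \<in> carrier_mat k m \<Longrightarrow> i < n \<Longrightarrow> j < m \<Longrightarrow>
    (A * B) $$ (i, j) = (\<Sum>l<k. A $$ (i, l) * B $$ (l, j))"
  by (auto simp: scalar_prod_def atLeast0LessThan)

lemma poly_mat_pCons:
  assumes A: "A \<in> carrier_mat n n"
  shows "poly_mat (pCons a p) A = a \<cdot>\<^sub>m 1\<^sub>m n + poly_mat p A * A"
proof (rule eq_matI)
  fix i j
  assume "i < dim_row (a \<cdot>\<^sub>m 1\<^sub>m n + poly_mat p A * A)" "j < dim_col (a \<cdot>\<^sub>m 1\<^sub>m n + poly_mat p A * A)"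
  then have ij: "i < n" "j < n" using A by auto
  have pc: "A ^\<^sub>m k \<in> carrier_mat n n" for k using A by simp
  have "poly_mat (pCons a p) A $$ (i, j) =
      (\<Sum>k\<le>Suc (degree p). coeff (pCons a p) k * (A ^\<^sub>m k) $$ (i, j))"
    by (rule poly_mat_index[OF A ij]) (rule degree_pCons_le)
  also have "\<dots> = a * 1\<^sub>m n $$ (i, j) + (\<Sum>k\<le>degree p. coeff p k * (A ^\<^sub>m k * A) $$ (i, j))"
    using A by (subst sum.atMost_Suc_shift) auto
  also have "(\<Sum>k\<le>degree p. coeff p k * (A ^\<^sub>m k * A) $$ (i, j)) =
      (\<Sum>l<n. (\<Sum>k\<le>degree p. coeff p k * (A ^\<^sub>m k) $$ (i, l)) * A $$ (l, j))"
    unfolding index_mult_mat_sum[OF pc A ij] sum_distrib_left sum_distrib_right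
    by (subst sum.swap) (simp add: mult.assoc)
  also have "\<dots> = (poly_mat p A * A) $$ (i, j)"
    unfolding index_mult_mat_sum[OF poly_mat_carrier[OF A] A ij]
    by (intro sum.cong refl) (simp add: poly_mat_index[OF A ij(1) _ order_refl])
  finally show "poly_mat (pCons a p) A $$ (i, j) = (a \<cdot>\<^sub>m 1\<^sub>m n + poly_mat p A * A) $$ (i, j)"
    using ij A by simp
qed (use A in \<open>auto simp: poly_mat_def\<close>)

lemma poly_mat_1 [simp]: "A \<in> carrier_mat n n \<Longrightarrow> poly_mat 1 A = 1\<^sub>m n"
  by (intro eq_matI) (auto simp: one_pCons poly_mat_pCons)

lemma poly_mat_linear: "A \<in> carrier_mat n n \<Longrightarrow> poly_mat [:a, 1:] A = A + a \<cdot>\<^sub>m 1\<^sub>m n"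
  by (rule eq_matI) (auto simp: poly_mat_pCons)

lemma poly_mat_add:
  assumes A: "A \<in> carrier_mat n n"
  shows "poly_mat (p + q) A = poly_mat p A + poly_mat q A"
proof (rule eq_matI)
  fix i j
  assume "i < dim_row (poly_mat p A + poly_mat q A)" "j < dim_col (poly_mat p A + poly_mat q A)"
  then have ij: "i < n" "j < n" using A by (auto simp: poly_mat_def)
  let ?N = "max (degree p) (degree q)"
  have "degree (p + q) \<le> ?N" "degree p \<le> ?N" "degree q \<le> ?N"
    by (auto intro: degree_add_le)
  from this[THEN poly_mat_index[OF A ij]] show
    "poly_mat (p + q) A $$ (i, j) = (poly_mat p A + poly_mat q A) $$ (i, j)"
    using ij A by (simp add: sum.distrib distrib_right poly_mat_def)
qed (use A in \<open>auto simp: poly_mat_def\<close>)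

lemma poly_mat_smult:
  assumes A: "A \<in> carrier_mat n n"
  shows "poly_mat (Polynomial.smult c p) A = c \<cdot>\<^sub>m poly_mat p A"
proof (rule eq_matI)
  fix i j
  assume "i < dim_row (c \<cdot>\<^sub>m poly_mat p A)" "j < dim_col (c \<cdot>\<^sub>m poly_mat p A)"
  then have ij: "i < n" "j < n" using A by (auto simp: poly_mat_def)
  show "poly_mat (Polynomial.smult c p) A $$ (i, j) = (c \<cdot>\<^sub>m poly_mat p A) $$ (i, j)"
    using ij A poly_mat_index[OF A ij degree_smult_le, of c p] poly_mat_index[OF A ij order_refl, of p]
    by (simp add: sum_distrib_left mult.assoc poly_mat_def)
qed (use A in \<open>auto simp: poly_mat_def\<close>)

lemma poly_mat_mult:
  assumes A: "A \<in> carrier_mat n n"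
  shows "poly_mat (p * q) A = poly_mat p A * poly_mat q A"
proof (induction q)
  case 0
  then show ?case
    using A by (simp add: right_mult_zero_mat[OF poly_mat_carrier[OF A]])
next
  case (pCons a q)
  have c: "poly_mat r A \<in> carrier_mat n n" for r using A by simp
  have "poly_mat (p * pCons a q) A = poly_mat (Polynomial.smult a p) A + poly_mat (pCons 0 (p * q)) A"
    by (simp add: poly_mat_add[OF A])
  also have "\<dots> = a \<cdot>\<^sub>m poly_mat p A + (0 \<cdot>\<^sub>m 1\<^sub>m n + poly_mat p A * poly_mat q A * A)"
    by (simp only: poly_mat_smult[OF A] poly_mat_pCons[OF A] pCons.IH)
  also have "0 \<cdot>\<^sub>m 1\<^sub>m n + poly_mat p A * poly_mat q A * A = poly_mat p A * (poly_mat q A * A)"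
  proof -
    have "0 \<cdot>\<^sub>m 1\<^sub>m n = (0\<^sub>m n n :: 'a mat)" by (rule eq_matI) auto
    then show ?thesis
      by (simp only: assoc_mult_mat[OF c c A] left_add_zero_mat[OF mult_carrier_mat[OF c mult_carrier_mat[OF c A]]])
  qed
  also have "a \<cdot>\<^sub>m poly_mat p A = poly_mat p A * (a \<cdot>\<^sub>m 1\<^sub>m n)"
    unfolding mult_smult_distrib[OF c one_carrier_mat] right_mult_one_mat[OF c] ..
  also have "poly_mat p A * (a \<cdot>\<^sub>m 1\<^sub>m n) + poly_mat p A * (poly_mat q A * A)
      = poly_mat p A * poly_mat (pCons a q) A"
    unfolding poly_mat_pCons[OF A]
    by (rule mult_add_distrib_mat[symmetric, OF c _ mult_carrier_mat[OF c A]]) simp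
  finally show ?case .
qed

lemma poly_mat_power:
  assumes A: "A \<in> carrier_mat n n"
  shows "poly_mat (p ^ k) A = poly_mat p A ^\<^sub>m k"
proof (induction k)
  case 0
  have "dim_row (poly_mat p A) = n" using A by (auto simp: poly_mat_def)
  then show ?case using A by simp
next
  case (Suc k)
  then show ?case by (simp only: power_Suc2 poly_mat_mult[OF A] pow_mat.simps)
qed

lemma poly_mat_pcompose:
  assumes A: "A \<in> carrier_mat n n"
  shows "poly_mat (pcompose p q) A = poly_mat p (poly_mat q A)"
proof (induction p)
  case 0
  then show ?case using A by (simp add: poly_mat_0[OF poly_mat_carrier[OF A]])
next
  case (pCons a p)
  have "poly_mat (pcompose (pCons a p) q) A = poly_mat [:a:] A + poly_mat (pcompose p q * q) A"
    by (simp add: pcompose_pCons poly_mat_add[OF A] mult.commute)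
  also have "\<dots> = a \<cdot>\<^sub>m 1\<^sub>m n + poly_mat p (poly_mat q A) * poly_mat q A"
    using A by (simp add: poly_mat_mult[OF A] pCons.IH poly_mat_pCons)
  finally show ?case
    by (simp add: poly_mat_pCons[OF poly_mat_carrier[OF A]])
qed

lemma poly_mat_commute:
  assumes A: "A \<in> carrier_mat n n" and B: "B \<in> carrier_mat n n" and AB: "B * A = A * B"
  shows "B * poly_mat p A = poly_mat p A * B"
proof (induction p)
  case 0
  then show ?case using A B by simp
next
  case (pCons a p)
  let ?P = "poly_mat p A"
  have c: "?P \<in> carrier_mat n n" using A by simp
  have "B * poly_mat (pCons a p) A = B * (a \<cdot>\<^sub>m 1\<^sub>m n) + B * (?P * A)"
    unfolding poly_mat_pCons[OF A]
    by (rule mult_add_distrib_mat[OF B _ mult_carrier_mat[OF c A]]) simp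
  also have "B * (?P * A) = ?P * A * B"
    using assoc_mult_mat[OF B c A] assoc_mult_mat[OF c B A] assoc_mult_mat[OF c A B]
    by (simp only: pCons.IH AB)
  also have "B * (a \<cdot>\<^sub>m 1\<^sub>m n) = a \<cdot>\<^sub>m 1\<^sub>m n * B"
    unfolding mult_smult_distrib[OF B one_carrier_mat] mult_smult_assoc_mat[OF one_carrier_mat B]
    using B by simp
  also have "a \<cdot>\<^sub>m 1\<^sub>m n * B + ?P * A * B = poly_mat (pCons a p) A * B"
    unfolding poly_mat_pCons[OF A]
    by (rule add_mult_distrib_mat[symmetric, OF _ mult_carrier_mat[OF c A] B]) simp
  finally show ?case .
qed

lemma poly_mat_comm:
  "A \<in> carrier_mat n n \<Longrightarrow> poly_mat p A * poly_mat q A = poly_mat q A * poly_mat p A"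
  by (metis poly_mat_mult mult.commute)

text \<open>The \<open>n\<^sup>2 + 1\<close> first powers of \<open>A\<close> are linearly dependent.\<close>

lemma ex_annihilating_poly:
  fixes A :: "'a::field mat"
  assumes A: "A \<in> carrier_mat n n"
  obtains p where "p \<noteq> 0" "poly_mat p A = 0\<^sub>m n n"
proof -
  let ?N = "Suc (n * n)"
  \<comment> \<open>Column \<open>k\<close> lists the entries of \<open>A ^\<^sub>m k\<close>, with
    entry (i, j) in row i * n + j. The last row is zero: it makes the matrix square and singular, so
    a kernel vector exists, and its entries are the coefficients sought.\<close>
  define M where "M = mat ?N ?N (\<lambda>(r, k). if r < n * n then (A ^\<^sub>m k) $$ (r div n, r mod n) else 0)"
  have M: "M \<in> carrier_mat ?N ?N" by (simp add: M_def)
  have "M = mat\<^sub>r ?N ?N (\<lambda>i. if i = n * n then 0\<^sub>v ?N else row M i)"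
    by (rule eq_matI) (auto simp: M_def)
  also have "det \<dots> = 0"
    by (rule det_row_0) (use M in auto)
  finally have "det M = 0" .
  then obtain v where v: "v \<in> carrier_vec ?N" "v \<noteq> 0\<^sub>v ?N" "M *\<^sub>v v = 0\<^sub>v ?N"
    using det_0_iff_vec_prod_zero[OF M] by auto
  define p where "p = (\<Sum>k<?N. Polynomial.monom (v $ k) k)"
  have cf: "coeff p k = (if k < ?N then v $ k else 0)" for k
    unfolding p_def by (simp add: coeff_sum)
  have "p \<noteq> 0"
  proof
    assume "p = 0"
    then have "v $ k = 0" if "k < ?N" for k using cf[of k] that by simp
    then have "v = 0\<^sub>v ?N" using v(1) by (intro eq_vecI) auto
    then show False using v(2) by simp
  qed
  have deg: "degree p \<le> n * n" by (rule degree_le) (auto simp: cf)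
  have "poly_mat p A = 0\<^sub>m n n"
  proof (rule eq_matI)
    fix i j assume "i < dim_row (0\<^sub>m n n :: 'a mat)" "j < dim_col (0\<^sub>m n n :: 'a mat)"
    then have ij: "i < n" "j < n" by auto
    let ?r = "i * n + j"
    have "?r < Suc i * n" using ij by simp
    also have "\<dots> \<le> n * n" using ij by (intro mult_right_mono) auto
    finally have r: "?r < n * n" .
    have "?r div n = i" "?r mod n = j" using ij by auto
    then have "(M *\<^sub>v v) $ ?r = (\<Sum>k<?N. (A ^\<^sub>m k) $$ (i, j) * v $ k)"
      using r v(1) by (simp add: M_def scalar_prod_def atLeast0LessThan)
    also have "\<dots> = poly_mat p A $$ (i, j)"
      unfolding poly_mat_index[OF A ij deg] by (intro sum.cong) (auto simp: cf lessThan_Suc_atMost)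
    finally show "poly_mat p A $$ (i, j) = 0\<^sub>m n n $$ (i, j)"
      using v(3) r ij by simp
  qed (use A in \<open>auto simp: poly_mat_def\<close>)
  with \<open>p \<noteq> 0\<close> show ?thesis by (rule that)
qed

text \<open>A monic split annihilator is wanted because both later uses handle its roots one by one:
  separating one root from the others, and shifting all of them.\<close>

lemma ex_annihilating_linear_product:
  fixes A :: "'a::alg_closed_field mat"
  assumes A: "A \<in> carrier_mat n n"
  obtains M where "poly_mat (\<Prod>x\<in>#M. [:-x, 1:]) A = 0\<^sub>m n n"
proof -
  obtain p where p: "p \<noteq> 0" "poly_mat p A = 0\<^sub>m n n"
    using ex_annihilating_poly[OF A] by blast
  from alg_closed_imp_factorization[OF p(1)] obtain M where
    M: "p = Polynomial.smult (lead_coeff p) (\<Prod>x\<in>#M. [:-x, 1:])" by blast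
  then have "(\<Prod>x\<in>#M. [:-x, 1:]) = Polynomial.smult (inverse (lead_coeff p)) p"
    using p(1) by (metis leading_coeff_0_iff left_inverse smult_1_left smult_smult)
  then have "poly_mat (\<Prod>x\<in>#M. [:-x, 1:]) A = inverse (lead_coeff p) \<cdot>\<^sub>m 0\<^sub>m n n"
    by (simp only: poly_mat_smult[OF A] p(2))
  then show ?thesis using that by simp
qed

text \<open>Coprimality is handled through Bezout coefficients, as polynomials over a field outside the
  class \<open>field_gcd\<close> have no \<open>gcd\<close>.\<close>

definition comaximal :: "'a::comm_ring_1 \<Rightarrow> 'a \<Rightarrow> bool" where
  "comaximal p q \<longleftrightarrow> (\<exists>a b. a * p + b * q = 1)"

lemma comaximal_sym: "comaximal p q \<Longrightarrow> comaximal q p"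
  unfolding comaximal_def by (metis add.commute)

lemma comaximal_mult:
  assumes "comaximal p q" "comaximal p r"
  shows "comaximal p (q * r)"
proof -
  obtain a b c d where 1: "a * p + b * q = 1" "c * p + d * r = 1"
    using assms unfolding comaximal_def by blast
  have "(a * p + b * q) * (c * p + d * r) = (a * c * p + a * d * r + b * q * c) * p + (b * d) * (q * r)"
    by (simp add: algebra_simps)
  then show ?thesis unfolding comaximal_def 1 by (metis mult_1)
qed

lemma comaximal_1: "comaximal p 1"
  unfolding comaximal_def by (rule exI[of _ 0], rule exI[of _ 1]) simp

lemma comaximal_power: "comaximal p q \<Longrightarrow> comaximal p (q ^ k)"
  by (induction k) (simp_all add: comaximal_1 comaximal_mult)

lemma comaximal_prod_mset:
  assumes "\<And>x. x \<in># M \<Longrightarrow> comaximal p (f x)"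
  shows "comaximal p (\<Prod>x\<in>#M. f x)"
  using assms by (induction M) (auto simp: comaximal_1 intro: comaximal_mult)

lemma comaximal_linear_poly:
  fixes a b :: "'a::field"
  assumes "a \<noteq> b"
  shows "comaximal [:-a, 1:] [:-b, 1:]"
  unfolding comaximal_def
proof (intro exI)
  \<comment> \<open>The difference (X - a) - (X - b) is the nonzero constant b - a.\<close>
  show "[:1 / (b - a):] * [:-a, 1:] + [:-1 / (b - a):] * [:-b, 1:] = 1"
  proof -
    have "1 / (b - a) * (- a) + - 1 / (b - a) * (- b) = 1"
      using assms by (simp add: divide_simps)
    then show ?thesis by (simp add: one_pCons)
  qed
qed

section \<open>Commutants and idempotents\<close>

lemma det_nonzero_inverse:
  fixes A :: "'a::field mat"
  assumes A: "A \<in> carrier_mat n n" and "det A \<noteq> 0"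
  obtains B where "B \<in> carrier_mat n n" "A * B = 1\<^sub>m n" "B * A = 1\<^sub>m n"
  using det_non_zero_imp_unit[OF assms, of undefined] that
  unfolding Units_def ring_mat_def by auto

section \<open>Nilpotent matrices with a cyclic vector\<close>

lemma index_mult_mat_vec_sum:
  "A \<in> carrier_mat n m \<Longrightarrow> v \<in> carrier_vec m \<Longrightarrow> i < n \<Longrightarrow>
    (A *\<^sub>v v) $ i = (\<Sum>j<m. A $$ (i, j) * v $ j)"
  by (auto simp: scalar_prod_def atLeast0LessThan)

lemma mult_mat_zero_vec: "A \<in> carrier_mat n m \<Longrightarrow> A *\<^sub>v 0\<^sub>v m = 0\<^sub>v n"
  by (rule eq_vecI) auto

lemma zero_mat_mult_vec: "v \<in> carrier_vec m \<Longrightarrow> 0\<^sub>m n m *\<^sub>v v = 0\<^sub>v n"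
  by (rule eq_vecI) auto

lemma smult_mat_mult_vec:
  "A \<in> carrier_mat n m \<Longrightarrow> v \<in> carrier_vec m \<Longrightarrow> (a \<cdot>\<^sub>m A) *\<^sub>v v = a \<cdot>\<^sub>v (A *\<^sub>v v)"
  by (rule eq_vecI) (auto simp: scalar_prod_def sum_distrib_left mult.assoc)

lemma poly_mat_X_power:
  assumes A: "A \<in> carrier_mat n n"
  shows "poly_mat ([:0, 1:] ^ k) A = A ^\<^sub>m k"
proof -
  have "poly_mat [:0, 1:] A = A"
    unfolding poly_mat_linear[OF A] using A by (intro eq_matI) auto
  then show ?thesis by (simp add: poly_mat_power[OF A])
qed

text \<open>This is linear independence of v, A v, ..., A^r v. Multiplying a relation by a suitable
  power of A pushes all its terms but the lowest beyond the last nonzero power on v, and the lowest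
  one survives.\<close>

lemma nilpotent_pow_vec_independent:
  fixes A :: "'a::field mat"
  assumes A: "A \<in> carrier_mat n n" and nil: "A ^\<^sub>m l = 0\<^sub>m n n"
    and v: "v \<in> carrier_vec n" "A ^\<^sub>m r *\<^sub>v v \<noteq> 0\<^sub>v n"
    and p: "p \<noteq> 0" "degree p \<le> r"
  shows "poly_mat p A *\<^sub>v v \<noteq> 0\<^sub>v n"
proof
  assume zero: "poly_mat p A *\<^sub>v v = 0\<^sub>v n"
  have c: "A ^\<^sub>m k \<in> carrier_mat n n" for k using A by simp
  have pc: "poly_mat q A \<in> carrier_mat n n" for q using A by simp
  let ?X = "[:0, 1:] :: 'a poly"
  define P where "P k \<longleftrightarrow> A ^\<^sub>m k *\<^sub>v v \<noteq> 0\<^sub>v n" for k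
  have zero_up: "A ^\<^sub>m (k + j) *\<^sub>v v = 0\<^sub>v n" if "A ^\<^sub>m j *\<^sub>v v = 0\<^sub>v n" for j k
  proof -
    have "A ^\<^sub>m (k + j) = A ^\<^sub>m k * A ^\<^sub>m j"
      by (simp only: poly_mat_X_power[OF A, symmetric] power_add poly_mat_mult[OF A])
    then show ?thesis
      using that assoc_mult_mat_vec[OF c c v(1), of k j] mult_mat_zero_vec[OF c, of k] by simp
  qed
  have "k < l" if "P k" for k
    using that zero_up[of l "k - l"] zero_mat_mult_vec[OF v(1)] nil unfolding P_def by (cases "k < l") auto
  moreover have "P r" using v(2) by (simp add: P_def)
  \<comment> \<open>The last power not killing v; nilpotency bounds it, and it may exceed
    \<open>r\<close>.\<close>
  ultimately obtain s where s: "P s" "\<And>k. P k \<Longrightarrow> k \<le> s"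
    using ex_has_greatest_nat[of P r id l] by (metis id_apply less_imp_le)
  have "r \<le> s" using s(2) \<open>P r\<close> by blast
  define e where "e = order 0 p"
  obtain q where q: "p = ?X ^ e * q" "\<not> ?X dvd q"
    using order_decomp[OF p(1), of 0] by (auto simp: e_def)
  obtain a q' where q': "q = pCons a q'" by (cases q)
  have "a \<noteq> 0"
    using q(2) poly_eq_0_iff_dvd[of q 0] by (auto simp: q')
  have "e \<le> s" using order_degree[OF p(1), of 0] p(2) \<open>r \<le> s\<close> by (simp add: e_def)
  \<comment> \<open>Here \<open>p\<close> is X^e times a polynomial with nonzero constant term
    \<open>a\<close>. The shift by s - e moves its lowest term to a X^s, and everything above kills
    v.\<close>
  have "?X ^ (s - e) * p = ?X ^ s * q"
    using \<open>e \<le> s\<close> unfolding q(1) by (simp flip: power_add mult.assoc)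
  also have "q = [:a:] + ?X * q'" by (simp add: q')
  also have "?X ^ s * ([:a:] + ?X * q') = Polynomial.smult a (?X ^ s) + q' * ?X ^ Suc s"
    by (simp add: algebra_simps)
  finally have eq: "?X ^ (s - e) * p = Polynomial.smult a (?X ^ s) + q' * ?X ^ Suc s" .
  have "0\<^sub>v n = poly_mat (?X ^ (s - e)) A *\<^sub>v (poly_mat p A *\<^sub>v v)"
    unfolding zero by (rule mult_mat_zero_vec[OF pc, symmetric])
  also have "\<dots> = poly_mat (?X ^ (s - e) * p) A *\<^sub>v v"
    unfolding poly_mat_mult[OF A] by (rule assoc_mult_mat_vec[OF pc pc v(1), symmetric])
  also have "\<dots> = (a \<cdot>\<^sub>m A ^\<^sub>m s + poly_mat q' A * A ^\<^sub>m Suc s) *\<^sub>v v"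
    unfolding eq poly_mat_add[OF A] poly_mat_smult[OF A] poly_mat_mult[OF A] poly_mat_X_power[OF A] ..
  also have "\<dots> = (a \<cdot>\<^sub>m A ^\<^sub>m s) *\<^sub>v v + (poly_mat q' A * A ^\<^sub>m Suc s) *\<^sub>v v"
    by (rule add_mult_distrib_mat_vec[OF smult_carrier_mat[OF c] mult_carrier_mat[OF pc c] v(1)])
  also have "(poly_mat q' A * A ^\<^sub>m Suc s) *\<^sub>v v = poly_mat q' A *\<^sub>v (A ^\<^sub>m Suc s *\<^sub>v v)"
    by (rule assoc_mult_mat_vec[OF pc c v(1)])
  also have "A ^\<^sub>m Suc s *\<^sub>v v = 0\<^sub>v n"
    using s(2)[of "Suc s"] unfolding P_def by auto
  also have "poly_mat q' A *\<^sub>v 0\<^sub>v n = 0\<^sub>v n"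
    by (rule mult_mat_zero_vec[OF pc])
  also have "(a \<cdot>\<^sub>m A ^\<^sub>m s) *\<^sub>v v + 0\<^sub>v n = a \<cdot>\<^sub>v (A ^\<^sub>m s *\<^sub>v v)"
    unfolding smult_mat_mult_vec[OF c v(1)] by (rule right_zero_vec) (simp add: mult_mat_vec_carrier[OF c v(1)])
  finally have *: "a \<cdot>\<^sub>v (A ^\<^sub>m s *\<^sub>v v) = 0\<^sub>v n" by simp
  have "A ^\<^sub>m s *\<^sub>v v = 0\<^sub>v n"
  proof (rule eq_vecI)
    fix i assume "i < dim_vec (0\<^sub>v n :: 'a vec)"
    then have i: "i < n" by simp
    then have "(a \<cdot>\<^sub>v (A ^\<^sub>m s *\<^sub>v v)) $ i = a * (A ^\<^sub>m s *\<^sub>v v) $ i"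
      using c[of s] by (intro index_smult_vec) auto
    then show "(A ^\<^sub>m s *\<^sub>v v) $ i = 0\<^sub>v n $ i"
      using * \<open>a \<noteq> 0\<close> i by simp
  qed (use c[of s] in auto)
  then show False using s(1) by (simp add: P_def)
qed

text \<open>A vector v with A^(n-1) v nonzero is cyclic: its iterates form a basis, so B v = p(A) v
  for some p. As B and p(A) both commute with A, they then agree on every A^k v.\<close>

lemma poly_mat_of_commute:
  fixes A B :: "'a::field mat"
  assumes A: "A \<in> carrier_mat n n" and nil: "A ^\<^sub>m l = 0\<^sub>m n n"
    and top: "A ^\<^sub>m (n - 1) \<noteq> 0\<^sub>m n n"
    and B: "B \<in> carrier_mat n n" and comm: "B * A = A * B"
  obtains p where "B = poly_mat p A"
proof -
  have c: "A ^\<^sub>m k \<in> carrier_mat n n" for k using A by simp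
  obtain i j where ij: "i < n" "j < n" "(A ^\<^sub>m (n - 1)) $$ (i, j) \<noteq> 0"
    using top c[of "n - 1"] by (metis carrier_matD eq_matI index_zero_mat)
  \<comment> \<open>Applied to this unit vector, \<open>A ^\<^sub>m (n - 1)\<close> yields its
    nonzero column \<open>j\<close>.\<close>
  define v :: "'a vec" where "v = unit_vec n j"
  have v: "v \<in> carrier_vec n" by (simp add: v_def)
  have "(M *\<^sub>v v) $ i = M $$ (i, j)" if "M \<in> carrier_mat n n" for M
    using that ij(1,2) by (simp add: v_def)
  then have "(A ^\<^sub>m (n - 1) *\<^sub>v v) $ i \<noteq> 0"
    using ij(3) c by metis
  then have Av: "A ^\<^sub>m (n - 1) *\<^sub>v v \<noteq> 0\<^sub>v n" using ij(1) by auto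
  \<comment> \<open>The columns of \<open>K\<close> are the iterates of v, so K u = p(A) v, where p
    has coefficient vector u. Independence of the iterates makes \<open>K\<close>
    invertible.\<close>
  define K where "K = mat n n (\<lambda>(i, k). (A ^\<^sub>m k *\<^sub>v v) $ i)"
  have K: "K \<in> carrier_mat n n" by (simp add: K_def)
  define P where "P u = (\<Sum>k<n. Polynomial.monom (u $ k) k)" for u :: "'a vec"
  have cf: "Polynomial.coeff (P u) k = (if k < n then u $ k else 0)" for u k
    unfolding P_def by (simp add: coeff_sum)
  have deg: "degree (P u) \<le> n - 1" for u by (rule degree_le) (auto simp: cf)
  have KP: "K *\<^sub>v u = poly_mat (P u) A *\<^sub>v v" if u: "u \<in> carrier_vec n" for u
  proof (rule eq_vecI)
    fix i assume "i < dim_vec (poly_mat (P u) A *\<^sub>v v)"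
    then have i: "i < n" using A by simp
    have "(K *\<^sub>v u) $ i = (\<Sum>k<n. (A ^\<^sub>m k *\<^sub>v v) $ i * u $ k)"
      using i u by (simp add: K_def scalar_prod_def atLeast0LessThan)
    also have "\<dots> = (\<Sum>k<n. \<Sum>j<n. u $ k * (A ^\<^sub>m k) $$ (i, j) * v $ j)"
      unfolding index_mult_mat_vec_sum[OF c v i] by (simp add: sum_distrib_left mult_ac)
    also have "\<dots> = (\<Sum>j<n. (\<Sum>k<n. u $ k * (A ^\<^sub>m k) $$ (i, j)) * v $ j)"
      by (subst sum.swap) (simp add: sum_distrib_right)
    also have "\<dots> = (\<Sum>j<n. poly_mat (P u) A $$ (i, j) * v $ j)"
    proof (intro sum.cong refl)
      fix j assume "j \<in> {..<n}"
      then have "poly_mat (P u) A $$ (i, j) = (\<Sum>k\<le>n - 1. Polynomial.coeff (P u) k * (A ^\<^sub>m k) $$ (i, j))"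
        using poly_mat_index[OF A i _ deg] by simp
      also have "\<dots> = (\<Sum>k<n. u $ k * (A ^\<^sub>m k) $$ (i, j))"
        using ij(1) by (intro sum.cong) (auto simp: cf)
      finally show "(\<Sum>k<n. u $ k * (A ^\<^sub>m k) $$ (i, j)) * v $ j = poly_mat (P u) A $$ (i, j) * v $ j"
        by simp
    qed
    also have "\<dots> = (poly_mat (P u) A *\<^sub>v v) $ i"
      by (rule index_mult_mat_vec_sum[OF poly_mat_carrier[OF A] v i, symmetric])
    finally show "(K *\<^sub>v u) $ i = (poly_mat (P u) A *\<^sub>v v) $ i" .
  qed (use A K in auto)
  have "det K \<noteq> 0"
  proof
    assume "det K = 0"
    then obtain u where u: "u \<in> carrier_vec n" "u \<noteq> 0\<^sub>v n" "K *\<^sub>v u = 0\<^sub>v n"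
      using det_0_iff_vec_prod_zero[OF K] by blast
    have "P u \<noteq> 0"
    proof
      assume "P u = 0"
      then have "u $ k = 0" if "k < n" for k using cf[of u k] that by simp
      then have "u = 0\<^sub>v n" using u(1) by (intro eq_vecI) auto
      then show False using u(2) by simp
    qed
    from nilpotent_pow_vec_independent[OF A nil v Av this deg] KP[OF u(1)] u(3)
    show False by simp
  qed
  then obtain L where L: "L \<in> carrier_mat n n" "K * L = 1\<^sub>m n"
    using det_nonzero_inverse[OF K] by blast
  define u where "u = L *\<^sub>v (B *\<^sub>v v)"
  have u: "u \<in> carrier_vec n" using L B v by (simp add: u_def)
  have pc: "poly_mat (P u) A \<in> carrier_mat n n" using A by simp
  have Bv: "B *\<^sub>v v \<in> carrier_vec n" using B v by simp
  have "K *\<^sub>v u = (K * L) *\<^sub>v (B *\<^sub>v v)"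
    unfolding u_def by (rule assoc_mult_mat_vec[OF K L(1) Bv, symmetric])
  then have BP: "B *\<^sub>v v = poly_mat (P u) A *\<^sub>v v"
    unfolding L(2) KP[OF u] using Bv by simp
  \<comment> \<open>The columns of \<open>K\<close> form the basis of iterates, so it suffices to
    compare both sides column by column; \<open>K\<close> is then cancelled by its right inverse
    \<open>L\<close>.\<close>
  have "B * K = poly_mat (P u) A * K"
  proof (rule mat_col_eqI)
    fix k assume "k < dim_col (poly_mat (P u) A * K)"
    then have k: "k < n" using K by simp
    have col: "col K k = A ^\<^sub>m k *\<^sub>v v"
      using k A by (intro eq_vecI) (auto simp: K_def)
    have BA: "B * A ^\<^sub>m k = A ^\<^sub>m k * B"
      using poly_mat_commute[OF A B comm, of "[:0, 1:] ^ k"] by (simp only: poly_mat_X_power[OF A])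
    have PA: "poly_mat (P u) A * A ^\<^sub>m k = A ^\<^sub>m k * poly_mat (P u) A"
      using poly_mat_comm[OF A, of "P u" "[:0, 1:] ^ k"] by (simp only: poly_mat_X_power[OF A])
    have "col (B * K) k = B *\<^sub>v (A ^\<^sub>m k *\<^sub>v v)"
      unfolding col[symmetric] by (rule col_mult2[OF B K k])
    also have "\<dots> = A ^\<^sub>m k *\<^sub>v (B *\<^sub>v v)"
      by (simp only: assoc_mult_mat_vec[OF B c v, symmetric] BA assoc_mult_mat_vec[OF c B v])
    also have "\<dots> = poly_mat (P u) A *\<^sub>v (A ^\<^sub>m k *\<^sub>v v)"
      by (simp only: BP assoc_mult_mat_vec[OF pc c v, symmetric] PA assoc_mult_mat_vec[OF c pc v])
    also have "\<dots> = col (poly_mat (P u) A * K) k"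
      unfolding col[symmetric] by (rule col_mult2[OF pc K k, symmetric])
    finally show "col (B * K) k = col (poly_mat (P u) A * K) k" .
  qed (use B K A in auto)
  then have "B * K * L = poly_mat (P u) A * K * L" by simp
  then have "B = poly_mat (P u) A"
    using assoc_mult_mat[OF B K L(1)] assoc_mult_mat[OF pc K L(1)] L(2)
      right_mult_one_mat[OF B] right_mult_one_mat[OF pc] by simp
  then show ?thesis by (rule that)
qed

section \<open>Rank factorizations and idempotents\<close>

text \<open>A kernel vector w with nonzero entry k expresses column k of A through the other
  columns, so that column can be deleted.\<close>

lemma singular_rank_factorization:
  fixes A :: "'a::field mat"
  assumes A: "A \<in> carrier_mat n n" and det: "det A = 0"
  obtains m U V where "m < n" "U \<in> carrier_mat n m" "V \<in> carrier_mat m n" "A = U * V"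
proof -
  obtain w where w: "w \<in> carrier_vec n" "w \<noteq> 0\<^sub>v n" "A *\<^sub>v w = 0\<^sub>v n"
    using det_0_iff_vec_prod_zero[OF A] det by blast
  obtain k where k: "k < n" "w $ k \<noteq> 0"
    using w(1,2) by (metis carrier_vecD eq_vecI index_zero_vec(1) index_zero_vec(2))
  define U where "U = mat n (n - 1) (\<lambda>(i, l). A $$ (i, insert_index k l))"
  \<comment> \<open>This is the identity minus w e_k^T / w_k. It satisfies A M = A because A w = 0,
    and its row \<open>k\<close> is zero, so deleting column \<open>k\<close> of A and row
    \<open>k\<close> of M does not change the product.\<close>
  define M where "M i j = (if i = j then 1 else 0) - (if j = k then w $ i / w $ k else 0)" for i j
  define V where "V = mat (n - 1) n (\<lambda>(l, j). M (insert_index k l) j)"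
  have inj: "inj_on (insert_index k) {..<n - 1}" using insert_index_inj_on by blast
  have im: "insert_index k ` {..<n - 1} = {..<n} - {k}"
    using k(1) insert_index_image[of k "n - 1"] by (simp add: lessThan_atLeast0)
  have "A = U * V"
  proof (rule eq_matI)
    fix i j assume "i < dim_row (U * V)" "j < dim_col (U * V)"
    then have ij: "i < n" "j < n" by (auto simp: U_def V_def)
    have "(U * V) $$ (i, j) = (\<Sum>l<n-1. A $$ (i, insert_index k l) * M (insert_index k l) j)"
      using ij by (subst index_mult_mat_sum[of U n "n - 1" V n]) (auto simp: U_def V_def)
    also have "\<dots> = (\<Sum>l\<in>{..<n} - {k}. A $$ (i, l) * M l j)"
      unfolding im[symmetric] sum.reindex[OF inj] by simp
    also have "\<dots> = (\<Sum>l<n. A $$ (i, l) * M l j)"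
      using k by (intro sum.mono_neutral_left) (auto simp: M_def)
    also have "\<dots> = (\<Sum>l<n. A $$ (i, l) * (if l = j then 1 else 0)) -
        (\<Sum>l<n. A $$ (i, l) * (if j = k then w $ l / w $ k else 0))"
      by (simp add: M_def right_diff_distrib sum_subtractf)
    also have "(\<Sum>l<n. A $$ (i, l) * (if l = j then 1 else 0)) = A $$ (i, j)"
    proof -
      have "A $$ (i, l) * (if l = j then 1 else 0) = (if l = j then A $$ (i, l) else 0)" for l
        by simp
      then show ?thesis using ij by simp
    qed
    also have "(\<Sum>l<n. A $$ (i, l) * (if j = k then w $ l / w $ k else 0)) =
        (if j = k then (\<Sum>l<n. A $$ (i, l) * w $ l) / w $ k else 0)"
      by (cases "j = k") (simp_all add: sum_divide_distrib)
    also have "(\<Sum>l<n. A $$ (i, l) * w $ l) = (A *\<^sub>v w) $ i"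
      using ij A w(1) by (auto simp: scalar_prod_def atLeast0LessThan)
    also have "\<dots> = 0" using w(3) ij by simp
    finally show "A $$ (i, j) = (U * V) $$ (i, j)" by simp
  qed (use A in \<open>auto simp: U_def V_def\<close>)
  moreover have "U \<in> carrier_mat n (n - 1)" "V \<in> carrier_mat (n - 1) n"
    by (auto simp: U_def V_def)
  ultimately show ?thesis using that[of "n - 1"] k(1) by simp
qed

text \<open>Take a factorization E = U V of least inner dimension m. If F = V U were singular, E = E
  E = U F V would factor through a smaller dimension. So F is invertible, and F^3 = F^2 forces F =
  1.\<close>

lemma idempotent_rank_factorization:
  fixes E :: "'a::field mat"
  assumes E: "E \<in> carrier_mat n n" and idem: "E * E = E"
  obtains m U V where "U \<in> carrier_mat n m" "V \<in> carrier_mat m n" "E = U * V" "V * U = 1\<^sub>m m"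
    "E \<noteq> 1\<^sub>m n \<Longrightarrow> m < n"
proof -
  define P where "P m \<longleftrightarrow> (\<exists>U\<in>carrier_mat n m. \<exists>V\<in>carrier_mat m n. E = U * V)" for m
  have "P n"
    unfolding P_def by (rule bexI[OF _ E], rule bexI[OF _ one_carrier_mat]) (use E in simp)
  define m where "m = (LEAST m. P m)"
  have "P m" unfolding m_def by (rule LeastI[of P, OF \<open>P n\<close>])
  then obtain U V where U: "U \<in> carrier_mat n m" and V: "V \<in> carrier_mat m n" and EUV: "E = U * V"
    unfolding P_def by blast
  have min: "m \<le> m'" if "P m'" for m' unfolding m_def by (rule Least_le[of P, OF that])
  define F where "F = V * U"
  have F: "F \<in> carrier_mat m m" unfolding F_def using U V by simp
  have UFV: "U * F * V = E"
    using idem assoc_mult_mat[OF U V mult_carrier_mat[OF U V]] assoc_mult_mat[OF V U V]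
      assoc_mult_mat[OF U F V] unfolding EUV by (simp flip: F_def)
  have "det F \<noteq> 0"
  proof
    assume "det F = 0"
    then obtain m' X Y where X: "m' < m" "X \<in> carrier_mat m m'" "Y \<in> carrier_mat m' m" "F = X * Y"
      using singular_rank_factorization[OF F] by blast
    have "E = (U * X) * (Y * V)"
      unfolding UFV[symmetric] X(4) assoc_mult_mat[OF U X(2,3), symmetric]
      by (rule assoc_mult_mat[OF mult_carrier_mat[OF U X(2)] X(3) V])
    then have "P m'" 
      unfolding P_def by (rule bexI[OF bexI[OF _ mult_carrier_mat[OF X(3) V]] mult_carrier_mat[OF U X(2)]])
    then show False using min X(1) by fastforce
  qed
  then obtain G where G: "G \<in> carrier_mat m m" "G * F = 1\<^sub>m m"
    using det_nonzero_inverse[OF F] by blast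
  have FV: "F * V \<in> carrier_mat m n" "U * F \<in> carrier_mat n m" using F U V by auto
  have "F * F * F = V * (U * F * V) * U"
    using assoc_mult_mat[OF V FV(2) V] assoc_mult_mat[OF V U F] assoc_mult_mat[OF mult_carrier_mat[OF F F] V U]
    by (simp flip: F_def)
  also have "\<dots> = V * (U * V) * U" unfolding UFV EUV ..
  also have "\<dots> = F * F"
    using assoc_mult_mat[OF V U V] assoc_mult_mat[OF F V U] by (simp flip: F_def)
  finally have FFF: "F * F * F = F * F" .
  have cancel: "X = Y" if "F * X = F * Y" "X \<in> carrier_mat m m" "Y \<in> carrier_mat m m" for X Y
    using that assoc_mult_mat[OF G(1) F that(2)] assoc_mult_mat[OF G(1) F that(3)] G(2)
    by (metis left_mult_one_mat)
  have "F * F = F"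
    by (rule cancel) (use FFF F assoc_mult_mat[OF F F F] in auto)
  then have "F = 1\<^sub>m m"
    by (intro cancel[OF _ F one_carrier_mat]) (use F in simp)
  moreover have "m < n" if "E \<noteq> 1\<^sub>m n"
  proof -
    \<comment> \<open>An invertible idempotent is the identity.\<close>
    have "det E = 0"
    proof (rule ccontr)
      assume "det E \<noteq> 0"
      then obtain D where D: "D \<in> carrier_mat n n" "D * E = 1\<^sub>m n"
        using det_nonzero_inverse[OF E] by blast
      have "E = D * E * E" using E D(2) by simp
      also have "\<dots> = 1\<^sub>m n" using assoc_mult_mat[OF D(1) E E] idem D(2) by simp
      finally show False using that by simp
    qed
    then obtain m' X Y where X: "m' < n" "X \<in> carrier_mat n m'" "Y \<in> carrier_mat m' n" "E = X * Y"
      using singular_rank_factorization[OF E] by blast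
    then have "P m'" unfolding P_def by blast
    then show ?thesis using min X(1) by fastforce
  qed
  ultimately show ?thesis using that U V EUV unfolding F_def by blast
qed

text \<open>Split an annihilator as l w, where l collects all factors X - x for one root x. A Bezout
  relation b w + a l = 1 makes (b w)(A) idempotent. If it is 1, then l(A) = 0 and A - x is
  nilpotent; if it is 0, then w(A) = 0 and w is an annihilator with fewer factors.\<close>

lemma nilpotent_or_idempotent:
  fixes A :: "'a::alg_closed_field mat"
  assumes A: "A \<in> carrier_mat n n"
  shows "(\<exists>x k. poly_mat [:-x, 1:] A ^\<^sub>m k = 0\<^sub>m n n) \<or>
    (\<exists>p. poly_mat p A * poly_mat p A = poly_mat p A \<and> poly_mat p A \<noteq> 0\<^sub>m n n \<and> poly_mat p A \<noteq> 1\<^sub>m n)"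
    (is "?nil \<or> ?idem")
proof -
  have "?nil \<or> ?idem" if "poly_mat (\<Prod>x\<in>#M. [:-x, 1:]) A = 0\<^sub>m n n" for M
    using that
  proof (induction M rule: measure_induct_rule[where f = size])
    case (less M)
    show ?case
    proof (cases "M = {#}")
      case True
      \<comment> \<open>An empty product annihilates only when n = 0; then every power is zero, in
        particular the zeroth.\<close>
      then have "1\<^sub>m n = (0\<^sub>m n n :: 'a mat)" using less.prems A by simp
      then have "poly_mat [:0, 1:] A ^\<^sub>m 0 = 0\<^sub>m n n" using A by simp
      then show ?thesis by (metis minus_zero)
    next
      case False
      then obtain x where x: "x \<in># M" by blast
      define l where "l = [:-x, 1:] ^ count M x"
      define N where "N = filter_mset (\<lambda>y. y \<noteq> x) M"
      define w where "w = (\<Prod>y\<in>#N. [:-y, 1:])"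
      have MN: "M = replicate_mset (count M x) x + N"
        unfolding N_def by (rule multiset_eqI) auto
      have lw: "(\<Prod>x\<in>#M. [:-x, 1:]) = l * w"
        by (subst MN) (simp add: l_def w_def)
      have "size N < size M"
        unfolding N_def using x by (metis (mono_tags, lifting) size_filter_unsat_elem)
      have "comaximal w [:-x, 1:]"
        unfolding w_def
        by (rule comaximal_sym, rule comaximal_prod_mset, rule comaximal_linear_poly) (auto simp: N_def)
      then have "comaximal w l"
        unfolding l_def by (rule comaximal_power)
      then obtain a b where ab: "b * w + a * l = 1"
        unfolding comaximal_def by blast
      let ?p = "b * w"
      have ann: "poly_mat (r * (l * w)) A = 0\<^sub>m n n" for r
        using less.prems A by (simp add: lw poly_mat_mult[OF A] right_mult_zero_mat[OF poly_mat_carrier[OF A]])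
      have eqI: "poly_mat r A = poly_mat s A" if "r = s + t * (l * w)" for r s t
        using that A by (simp add: poly_mat_add[OF A] ann)
      show ?thesis
      proof (cases "?idem")
        case no_idem: False
        \<comment> \<open>Modulo l w the product of b w and a l is zero, and their sum is 1, so b w
          is idempotent there.\<close>
        have "?p * ?p + (a * b) * (l * w) = ?p * (b * w + a * l)" by (simp add: algebra_simps)
        then have "?p = ?p * ?p + (a * b) * (l * w)" using ab by simp
        then have "poly_mat ?p A * poly_mat ?p A = poly_mat ?p A"
          unfolding poly_mat_mult[OF A, symmetric] by (metis eqI)
        with no_idem consider "poly_mat ?p A = 0\<^sub>m n n" | "poly_mat ?p A = 1\<^sub>m n" by blast
        then show ?thesis
        proof cases
          case 1
          have "w * ?p + a * (l * w) = w * (b * w + a * l)" by (simp add: algebra_simps)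
          then have "w = w * ?p + a * (l * w)" using ab by simp
          then have "poly_mat w A = poly_mat (w * ?p) A" by (rule eqI)
          also have "\<dots> = 0\<^sub>m n n" unfolding poly_mat_mult[OF A, of w] 1 using A by simp
          finally show ?thesis using less.IH \<open>size N < size M\<close> unfolding w_def by blast
        next
          case 2
          have "poly_mat l A = poly_mat (l * ?p) A"
            unfolding poly_mat_mult[OF A, of l] 2 using A by simp
          also have "\<dots> = poly_mat (b * (l * w)) A" by (simp add: mult_ac)
          also have "\<dots> = 0\<^sub>m n n" by (rule ann)
          finally show ?thesis unfolding l_def poly_mat_power[OF A] by blast
        qed
      qed blast
    qed
  qed
  with ex_annihilating_linear_product[OF A] show ?thesis by metis
qed

section \<open>Algebras of functions\<close>

text \<open>One closure argument for two cases: regular functions on matrix tuples, which give maps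
  compatible with closures, and polynomial functions of one parameter, which give curves. Membership
  depends only on values on \<open>T\<close>, since matrix entries obey the expected formulas only
  where the dimensions are right.\<close>

locale function_algebra =
  fixes T :: "'t set" and F :: "('t \<Rightarrow> 'a::comm_ring_1) set"
  assumes const: "(\<lambda>_. c) \<in> F"
    and add: "f \<in> F \<Longrightarrow> g \<in> F \<Longrightarrow> (\<lambda>t. f t + g t) \<in> F"
    and mult: "f \<in> F \<Longrightarrow> g \<in> F \<Longrightarrow> (\<lambda>t. f t * g t) \<in> F"
    and cong: "f \<in> F \<Longrightarrow> (\<And>t. t \<in> T \<Longrightarrow> f t = g t) \<Longrightarrow> g \<in> F"
begin

lemma sum: "(\<And>i. i \<in> I \<Longrightarrow> f i \<in> F) \<Longrightarrow> (\<lambda>t. \<Sum>i\<in>I. f i t) \<in> F"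
  by (induction I rule: infinite_finite_induct) (auto intro: const add)

lemma power: "f \<in> F \<Longrightarrow> (\<lambda>t. f t ^ k) \<in> F"
  by (induction k) (auto intro: const mult)

lemma prod: "(\<And>i. i \<in> I \<Longrightarrow> f i \<in> F) \<Longrightarrow> (\<lambda>t. \<Prod>i\<in>I. f i t) \<in> F"
  by (induction I rule: infinite_finite_induct) (auto intro: const mult)

lemma mpoly_eval:
  assumes "p \<in> mpolys_in V" "\<And>v. v \<in> V \<Longrightarrow> x v \<in> F"
  shows "(\<lambda>t. mpoly_eval p (\<lambda>v. x v t)) \<in> F"
  unfolding mpoly_eval_def monom_eval_def
  using assms by (intro sum mult const prod power) (auto simp: mpolys_in_def)

definition mat_fun :: "nat \<Rightarrow> nat \<Rightarrow> ('t \<Rightarrow> 'a mat) set" where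
  "mat_fun n m = {M. (\<forall>t\<in>T. M t \<in> carrier_mat n m) \<and>
     (\<forall>i<n. \<forall>j<m. (\<lambda>t. M t $$ (i, j)) \<in> F)}"

lemma mat_fun_const: "A \<in> carrier_mat n m \<Longrightarrow> (\<lambda>_. A) \<in> mat_fun n m"
  by (simp add: mat_fun_def const)

lemma mat_fun_add:
  assumes "A \<in> mat_fun n m" "B \<in> mat_fun n m"
  shows "(\<lambda>t. A t + B t) \<in> mat_fun n m"
proof -
  have "(\<lambda>t. (A t + B t) $$ (i, j)) \<in> F" if "i < n" "j < m" for i j
  proof (rule cong[OF add])
    show "(\<lambda>t. A t $$ (i, j)) \<in> F" "(\<lambda>t. B t $$ (i, j)) \<in> F"
      using assms that by (auto simp: mat_fun_def)
    fix t assume "t \<in> T"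
    then have "A t \<in> carrier_mat n m" "B t \<in> carrier_mat n m"
      using assms by (auto simp: mat_fun_def)
    then show "A t $$ (i, j) + B t $$ (i, j) = (A t + B t) $$ (i, j)"
      using that by auto
  qed
  moreover have "A t + B t \<in> carrier_mat n m" if "t \<in> T" for t
    using assms that by (auto simp: mat_fun_def)
  ultimately show ?thesis by (simp add: mat_fun_def)
qed

lemma mat_fun_mult:
  assumes "A \<in> mat_fun n k" "B \<in> mat_fun k m"
  shows "(\<lambda>t. A t * B t) \<in> mat_fun n m"
proof -
  have "(\<lambda>t. (A t * B t) $$ (i, j)) \<in> F" if "i < n" "j < m" for i j
  proof (rule cong[OF sum[of "{..<k}"]])
    show "(\<lambda>t. A t $$ (i, l) * B t $$ (l, j)) \<in> F" if "l \<in> {..<k}" for l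
      using assms that \<open>i < n\<close> \<open>j < m\<close> by (intro mult) (auto simp: mat_fun_def)
    fix t assume "t \<in> T"
    then have "A t \<in> carrier_mat n k" "B t \<in> carrier_mat k m"
      using assms by (auto simp: mat_fun_def)
    then show "(\<Sum>l<k. A t $$ (i, l) * B t $$ (l, j)) = (A t * B t) $$ (i, j)"
      using that by (simp only: index_mult_mat_sum)
  qed
  moreover have "A t * B t \<in> carrier_mat n m" if "t \<in> T" for t
    using assms that by (auto simp: mat_fun_def)
  ultimately show ?thesis by (simp add: mat_fun_def)
qed

lemma mat_fun_smult:
  assumes "f \<in> F" "A \<in> mat_fun n m"
  shows "(\<lambda>t. f t \<cdot>\<^sub>m A t) \<in> mat_fun n m"
proof -
  have "(\<lambda>t. (f t \<cdot>\<^sub>m A t) $$ (i, j)) \<in> F" if "i < n" "j < m" for i j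
  proof (rule cong[OF mult])
    show "f \<in> F" "(\<lambda>t. A t $$ (i, j)) \<in> F"
      using assms that by (auto simp: mat_fun_def)
    fix t assume "t \<in> T"
    then have "A t \<in> carrier_mat n m"
      using assms by (auto simp: mat_fun_def)
    then show "f t * A t $$ (i, j) = (f t \<cdot>\<^sub>m A t) $$ (i, j)"
      using that by auto
  qed
  moreover have "f t \<cdot>\<^sub>m A t \<in> carrier_mat n m" if "t \<in> T" for t
    using assms that by (auto simp: mat_fun_def)
  ultimately show ?thesis by (simp add: mat_fun_def)
qed

lemma mat_fun_cong:
  assumes "A \<in> mat_fun n m" "\<And>t. t \<in> T \<Longrightarrow> A t = B t"
  shows "B \<in> mat_fun n m"
proof -
  have "(\<lambda>t. B t $$ (i, j)) \<in> F" if "i < n" "j < m" for i j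
    by (rule cong[of "\<lambda>t. A t $$ (i, j)"]) (use assms that in \<open>auto simp: mat_fun_def\<close>)
  moreover have "B t \<in> carrier_mat n m" if "t \<in> T" for t
    using assms(1) assms(2)[OF that, symmetric] that by (auto simp: mat_fun_def)
  ultimately show ?thesis by (simp add: mat_fun_def)
qed

lemma mat_fun_pow:
  assumes "A \<in> mat_fun n n"
  shows "(\<lambda>t. A t ^\<^sub>m k) \<in> mat_fun n n"
proof (induction k)
  case 0
  show ?case
    by (rule mat_fun_cong[OF mat_fun_const[OF one_carrier_mat]]) (use assms in \<open>auto simp: mat_fun_def\<close>)
next
  case (Suc k)
  then show ?case by (simp add: mat_fun_mult[OF _ assms])
qed

lemma mat_fun_poly_mat:
  assumes "A \<in> mat_fun n n"
  shows "(\<lambda>t. poly_mat p (A t)) \<in> mat_fun n n"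
proof (induction p)
  case 0
  show ?case
    by (rule mat_fun_cong[OF mat_fun_const[OF zero_carrier_mat]])
      (use assms in \<open>auto simp: mat_fun_def\<close>)
next
  case (pCons a p)
  have "(\<lambda>t. a \<cdot>\<^sub>m 1\<^sub>m n + poly_mat p (A t) * A t) \<in> mat_fun n n"
    by (intro mat_fun_add mat_fun_mult[OF _ assms] pCons mat_fun_const) simp
  then show ?case
    by (rule mat_fun_cong) (use assms in \<open>auto simp: mat_fun_def poly_mat_pCons\<close>)
qed

text \<open>Pullback of an equation: composing a polynomial in the entries with a matrix-valued
  family stays in the algebra.\<close>

lemma mpoly_eval_entries:
  assumes "p \<in> mpolys_in (entry_vars d n)" "\<And>k. k < d \<Longrightarrow> (\<lambda>t. G t ! k) \<in> mat_fun n n"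
  shows "(\<lambda>t. mpoly_eval p (entries (G t))) \<in> F"
proof -
  have "(\<lambda>t. entries (G t) v) \<in> F" if "v \<in> entry_vars d n" for v
    using assms(2) that by (auto simp: entry_vars_def entries_def mat_fun_def)
  then show ?thesis using mpoly_eval[OF assms(1), of "\<lambda>v t. entries (G t) v"] by simp
qed

end

definition regular_functions :: "nat \<Rightarrow> nat \<Rightarrow> ('a::comm_ring_1 mat list \<Rightarrow> 'a) set" where
  "regular_functions d n = {f. \<exists>p\<in>mpolys_in (entry_vars d n). \<forall>As\<in>mat_tuples d n.
     f As = mpoly_eval p (entries As)}"

lemma mpolys_in_add:
  assumes "p \<in> mpolys_in V" "q \<in> mpolys_in V"
  shows "p + q \<in> mpolys_in V"
  using assms Poly_Mapping.keys_add[of p q] unfolding mpolys_in_def by blast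

interpretation regular: function_algebra "mat_tuples d n"
    "regular_functions d n :: ('a::comm_ring_1 mat list \<Rightarrow> 'a) set" for d n
proof
  fix f g :: "'a mat list \<Rightarrow> 'a" and c :: 'a
  have "Poly_Mapping.single 0 c \<in> mpolys_in (entry_vars d n)"
    by (auto simp: mpolys_in_def)
  moreover have "mpoly_eval (Poly_Mapping.single 0 c) x = c" for x :: "nat \<times> nat \<times> nat \<Rightarrow> 'a"
    by (simp add: mpoly_eval_single monom_eval_def)
  ultimately show "(\<lambda>_. c) \<in> regular_functions d n"
    unfolding regular_functions_def by (intro CollectI) (metis (no_types, lifting))
  show "(\<lambda>t. f t + g t) \<in> regular_functions d n"
    if "f \<in> regular_functions d n" "g \<in> regular_functions d n"
    using that unfolding regular_functions_def
    by (auto simp: mpoly_eval_add intro!: bexI[OF _ mpolys_in_add])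
  show "(\<lambda>t. f t * g t) \<in> regular_functions d n"
    if "f \<in> regular_functions d n" "g \<in> regular_functions d n"
    using that unfolding regular_functions_def
    by (auto simp: mpoly_eval_mult intro!: bexI[OF _ mpolys_in_mult])
  show "g \<in> regular_functions d n"
    if "f \<in> regular_functions d n" "\<And>As. As \<in> mat_tuples d n \<Longrightarrow> f As = g As"
    using that unfolding regular_functions_def by auto
qed

lemma regular_nth:
  assumes "k < d"
  shows "(\<lambda>As :: 'a::comm_ring_1 mat list. As ! k) \<in> regular.mat_fun d n n n"
proof -
  have "(\<lambda>As :: 'a mat list. (As ! k) $$ (i, j)) \<in> regular_functions d n" if "i < n" "j < n" for i j
  proof -
    let ?p = "Poly_Mapping.single (Poly_Mapping.single (k, i, j) 1) 1 ::
      (nat \<times> nat \<times> nat, 'a) mpolynomial"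
    have p: "?p \<in> mpolys_in (entry_vars d n)"
      using that assms by (auto simp: mpolys_in_def entry_vars_def)
    have eq: "(As ! k) $$ (i, j) = mpoly_eval ?p (entries As)" for As
      by (simp add: mpoly_eval_single monom_eval_def entries_def)
    show ?thesis
      unfolding regular_functions_def by (rule CollectI, rule bexI[OF _ p], rule ballI, rule eq)
  qed
  moreover have "As ! k \<in> carrier_mat n n" if "As \<in> mat_tuples d n" for As :: "'a mat list"
    using that assms nth_mem[of k As] unfolding mat_tuples_def by blast
  ultimately show ?thesis by (simp add: regular.mat_fun_def)
qed

interpretation polyfun: function_algebra UNIV "range poly :: ('a::comm_ring_1 \<Rightarrow> 'a) set"
proof
  fix f g :: "'a \<Rightarrow> 'a" and c :: 'a
  show "(\<lambda>_. c) \<in> range poly"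
    by (rule range_eqI[of _ _ "[:c:]"]) auto
  show "(\<lambda>t. f t + g t) \<in> range poly" if "f \<in> range poly" "g \<in> range poly"
  proof -
    from that obtain p q where "f = poly p" "g = poly q" by blast
    then show ?thesis by (intro range_eqI[of _ _ "p + q"]) auto
  qed
  show "(\<lambda>t. f t * g t) \<in> range poly" if "f \<in> range poly" "g \<in> range poly"
  proof -
    from that obtain p q where "f = poly p" "g = poly q" by blast
    then show ?thesis by (intro range_eqI[of _ _ "p * q"]) auto
  qed
  show "g \<in> range poly" if "f \<in> range poly" "\<And>t. t \<in> UNIV \<Longrightarrow> f t = g t"
  proof -
    have "f = g" using that(2) by auto
    then show ?thesis using that(1) by simp
  qed
qed

section \<open>Zariski closure and irreducibility\<close>

definition vanishes_on :: "(nat \<times> nat \<times> nat, 'a::comm_semiring_1) mpolynomial \<Rightarrow> 'a mat list set \<Rightarrow> bool" where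
  "vanishes_on p S \<longleftrightarrow> (\<forall>As\<in>S. mpoly_eval p (entries As) = 0)"

text \<open>The Zariski closure of \<open>S\<close>, as the common zeros of its vanishing
  ideal.\<close>

definition zariski_hull :: "nat \<Rightarrow> nat \<Rightarrow> 'a::comm_semiring_1 mat list set \<Rightarrow> 'a mat list set" where
  "zariski_hull d n S = {As \<in> mat_tuples d n.
     \<forall>p\<in>mpolys_in (entry_vars d n). vanishes_on p S \<longrightarrow> mpoly_eval p (entries As) = 0}"

lemma zariski_hull_superset: "S \<subseteq> mat_tuples d n \<Longrightarrow> S \<subseteq> zariski_hull d n S"
  by (auto simp: zariski_hull_def vanishes_on_def)

text \<open>Continuity of a regular map: a polynomial vanishing on \<open>S'\<close> pulls back to
  one vanishing on \<open>S\<close>, hence on the closure of \<open>S\<close>. The source and target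
  may have different matrix sizes, as block sums require.\<close>

lemma zariski_hull_image:
  fixes G :: "'a::comm_ring_1 mat list \<Rightarrow> 'a mat list"
  assumes "\<And>k. k < d \<Longrightarrow> (\<lambda>As. G As ! k) \<in> regular.mat_fun e m n n"
    and "\<And>As. As \<in> mat_tuples e m \<Longrightarrow> length (G As) = d"
    and "S \<subseteq> mat_tuples e m"
    and S: "\<And>As. As \<in> S \<Longrightarrow> G As \<in> zariski_hull d n S'"
    and As: "As \<in> zariski_hull e m S"
  shows "G As \<in> zariski_hull d n S'"
proof -
  have "mpoly_eval p (entries (G As)) = 0"
    if p: "p \<in> mpolys_in (entry_vars d n)" "vanishes_on p S'" for p
  proof -
    have "(\<lambda>As. mpoly_eval p (entries (G As))) \<in> regular_functions e m"
      by (rule regular.mpoly_eval_entries[OF p(1) assms(1)])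
    then obtain q where q: "q \<in> mpolys_in (entry_vars e m)"
      "\<And>As. As \<in> mat_tuples e m \<Longrightarrow> mpoly_eval p (entries (G As)) = mpoly_eval q (entries As)"
      unfolding regular_functions_def by blast
    have "mpoly_eval q (entries Bs) = 0" if "Bs \<in> S" for Bs
      using S[OF that] p q(2)[of Bs] \<open>S \<subseteq> mat_tuples e m\<close> that
      by (auto simp: zariski_hull_def)
    then have "vanishes_on q S" by (simp add: vanishes_on_def)
    then show ?thesis
      using As q by (auto simp: zariski_hull_def)
  qed
  moreover have "G As \<in> mat_tuples d n"
  proof -
    have "As \<in> mat_tuples e m" using As by (simp add: zariski_hull_def)
    then have "length (G As) = d" "\<And>k. k < d \<Longrightarrow> G As ! k \<in> carrier_mat n n"
      using assms(1,2) by (auto simp: regular.mat_fun_def)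
    then show ?thesis by (auto simp: mat_tuples_def in_set_conv_nth)
  qed
  ultimately show ?thesis by (simp add: zariski_hull_def)
qed

text \<open>The condition on the right is primality of the vanishing ideal. It suffices to test
  hypersurfaces: a proper closed subset misses a point because of one of its equations.\<close>

lemma zariski_irreducible_iff:
  fixes S :: "'a::idom mat list set"
  assumes S: "S \<subseteq> mat_tuples d n"
  shows "zariski_irreducible d n S \<longleftrightarrow> S \<noteq> {} \<and>
    (\<forall>p\<in>mpolys_in (entry_vars d n). \<forall>q\<in>mpolys_in (entry_vars d n).
       vanishes_on (p * q) S \<longrightarrow> vanishes_on p S \<or> vanishes_on q S)"
    (is "_ \<longleftrightarrow> _ \<and> ?R")
proof -
  have top: "topspace (subtopology (zariski_topology d n) S) = S"
    using S by auto
  have cl: "closedin (subtopology (zariski_topology d n) S) Y \<longleftrightarrow>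
      (\<exists>P\<subseteq>mpolys_in (entry_vars d n). Y = zero_locus d n P \<inter> S)" for Y
    unfolding closedin_subtopology closedin_zariski_topology by blast
  have locus: "zero_locus d n P \<inter> S = S \<longleftrightarrow> (\<forall>p\<in>P. vanishes_on p S)" for P
    using S unfolding zero_locus_def vanishes_on_def by blast
  have "?R \<longleftrightarrow> (\<forall>Y Z. closedin (subtopology (zariski_topology d n) S) Y \<and>
      closedin (subtopology (zariski_topology d n) S) Z \<and> S = Y \<union> Z \<longrightarrow> S = Y \<or> S = Z)"
  proof (intro iffI allI ballI impI; (elim conjE)?)
    fix Y Z assume R: ?R and "closedin (subtopology (zariski_topology d n) S) Y"
      "closedin (subtopology (zariski_topology d n) S) Z" and U: "S = Y \<union> Z"
    then obtain P Q where P: "P \<subseteq> mpolys_in (entry_vars d n)" "Y = zero_locus d n P \<inter> S"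
      and Q: "Q \<subseteq> mpolys_in (entry_vars d n)" "Z = zero_locus d n Q \<inter> S"
      unfolding cl by blast
    show "S = Y \<or> S = Z"
    proof (rule disjCI)
      assume "S \<noteq> Z"
      then obtain q where q: "q \<in> Q" "\<not> vanishes_on q S"
        using locus[of Q] Q(2) by blast
      \<comment> \<open>Every product of an equation of \<open>Y\<close> with one of
        \<open>Z\<close> vanishes on their union \<open>S\<close>; as \<open>q\<close> does not,
        each \<open>p\<close> must.\<close>
      have "vanishes_on p S" if "p \<in> P" for p
      proof -
        have "vanishes_on (p * q) S"
          unfolding vanishes_on_def
        proof
          fix As assume "As \<in> S"
          then have "As \<in> zero_locus d n P \<or> As \<in> zero_locus d n Q"
            using U P(2) Q(2) by blast
          then show "mpoly_eval (p * q) (entries As) = 0"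
            using that q(1) by (auto simp: zero_locus_def mpoly_eval_mult)
        qed
        then show ?thesis using R that q P(1) Q(1) by blast
      qed
      then show "S = Y" using locus[of P] P(2) by blast
    qed
  next
    fix p q
    assume *: "\<forall>Y Z. closedin (subtopology (zariski_topology d n) S) Y \<and>
      closedin (subtopology (zariski_topology d n) S) Z \<and> S = Y \<union> Z \<longrightarrow> S = Y \<or> S = Z"
      and p: "p \<in> mpolys_in (entry_vars d n)" and q: "q \<in> mpolys_in (entry_vars d n)"
      and "vanishes_on (p * q) S"
    let ?Y = "zero_locus d n {p} \<inter> S" and ?Z = "zero_locus d n {q} \<inter> S"
    have "S = ?Y \<union> ?Z"
      using \<open>vanishes_on (p * q) S\<close> S by (auto simp: vanishes_on_def zero_locus_def mpoly_eval_mult)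
    moreover have "closedin (subtopology (zariski_topology d n) S) ?Y"
      "closedin (subtopology (zariski_topology d n) S) ?Z"
      unfolding cl using p q by blast+
    ultimately have "?Y = S \<or> ?Z = S" using * by metis
    then show "vanishes_on p S \<or> vanishes_on q S"
      unfolding locus by simp
  qed
  then show ?thesis
    unfolding zariski_irreducible_def irreducible_space_def top by blast
qed

text \<open>Two points joined by a curve in \<open>S\<close> with polynomial entries cannot be separated by closed
  sets covering \<open>S\<close>, as a polynomial in one variable over an infinite field has few roots.\<close>

lemma vanishes_on_factor_if_curves:
  fixes S :: "'a::idom mat list set"
  assumes inf: "infinite (UNIV :: 'a set)"
    and curve: "\<And>As Bs. As \<in> S \<Longrightarrow> Bs \<in> S \<Longrightarrow> \<exists>G. (\<forall>t. G t \<in> S) \<and> G 0 = As \<and> G 1 = Bs \<and>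
      (\<forall>k<d. (\<lambda>t. G t ! k) \<in> polyfun.mat_fun n n)"
    and p: "p \<in> mpolys_in (entry_vars d n)" and q: "q \<in> mpolys_in (entry_vars d n)"
    and pq: "vanishes_on (p * q) S"
  shows "vanishes_on p S \<or> vanishes_on q S"
proof (rule ccontr)
  assume "\<not> ?thesis"
  then obtain As Bs where As: "As \<in> S" "mpoly_eval p (entries As) \<noteq> 0"
    and Bs: "Bs \<in> S" "mpoly_eval q (entries Bs) \<noteq> 0"
    by (auto simp: vanishes_on_def)
  then obtain G where G: "\<And>t. G t \<in> S" "G 0 = As" "G 1 = Bs"
    and alg: "\<And>k. k < d \<Longrightarrow> (\<lambda>t. G t ! k) \<in> polyfun.mat_fun n n"
    using curve by meson
  obtain f where f: "(\<lambda>t. mpoly_eval p (entries (G t))) = poly f"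
    using polyfun.mpoly_eval_entries[OF p alg] by blast
  obtain g where g: "(\<lambda>t. mpoly_eval q (entries (G t))) = poly g"
    using polyfun.mpoly_eval_entries[OF q alg] by blast
  have "poly f 0 \<noteq> 0" "poly g 1 \<noteq> 0"
    using fun_cong[OF f, of 0] fun_cong[OF g, of 1] As Bs G by auto
  then have "f * g \<noteq> 0" by auto
  moreover have "poly (f * g) t = 0" for t
  proof -
    have "mpoly_eval (p * q) (entries (G t)) = 0"
      using pq G(1)[of t] unfolding vanishes_on_def by blast
    then show ?thesis
      using fun_cong[OF f, of t] fun_cong[OF g, of t] by (simp add: mpoly_eval_mult)
  qed
  then have "{t. poly (f * g) t = 0} = UNIV" by blast
  ultimately show False using poly_roots_finite[of "f * g"] inf by simp
qed

section \<open>Tuples of polynomials in one matrix\<close>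

definition one_matrix_tuples :: "nat \<Rightarrow> nat \<Rightarrow> 'a::comm_ring_1 mat list set" where
  "one_matrix_tuples d n = {map (\<lambda>p. poly_mat p X) ps | X ps. X \<in> carrier_mat n n \<and> length ps = d}"

lemma one_matrix_tuples_subset: "one_matrix_tuples d n \<subseteq> commuting_variety d n"
  by (auto simp: one_matrix_tuples_def commuting_variety_def mat_tuples_def intro: poly_mat_comm)

lemma one_matrix_tuples_subset_mat_tuples: "one_matrix_tuples d n \<subseteq> mat_tuples d n"
  using one_matrix_tuples_subset by (force simp: commuting_variety_def)

text \<open>Over a finite field the product of all X - a, plus 1, has positive degree but no
  root.\<close>

lemma infinite_alg_closed_field: "infinite (UNIV :: 'a::alg_closed_field set)"
proof
  assume fin: "finite (UNIV :: 'a set)"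
  let ?p = "(\<Prod>a\<in>(UNIV :: 'a set). [:-a, 1:]) + 1"
  have val: "poly ?p x = 1" for x :: 'a
    using fin by (auto simp: poly_prod)
  have "degree (\<Prod>a\<in>(UNIV :: 'a set). [:-a, 1:]) = card (UNIV :: 'a set)"
    by (subst degree_prod_eq_sum_degree) auto
  then have "degree ?p = card (UNIV :: 'a set)"
    using fin by (subst degree_add_eq_left) (auto simp: card_gt_0_iff)
  then have "degree ?p > 0" using fin by (simp add: card_gt_0_iff)
  then obtain x where "poly ?p x = 0"
    using alg_closed_imp_poly_has_root by blast
  then show False using val by simp
qed

text \<open>The matrix and the coefficients of the polynomials are interpolated linearly at the same
  time, so every intermediate tuple still consists of polynomials in a single matrix.\<close>

lemma one_matrix_tuples_curve:
  fixes As Bs :: "'a::comm_ring_1 mat list"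
  assumes "As \<in> one_matrix_tuples d n" "Bs \<in> one_matrix_tuples d n"
  shows "\<exists>G. (\<forall>t. G t \<in> one_matrix_tuples d n) \<and> G 0 = As \<and> G 1 = Bs \<and>
      (\<forall>k<d. (\<lambda>t. G t ! k) \<in> polyfun.mat_fun n n)"
proof -
  obtain X ps where X: "X \<in> carrier_mat n n" "length ps = d" "As = map (\<lambda>p. poly_mat p X) ps"
    using assms(1) unfolding one_matrix_tuples_def by blast
  obtain Y qs where Y: "Y \<in> carrier_mat n n" "length qs = d" "Bs = map (\<lambda>p. poly_mat p Y) qs"
    using assms(2) unfolding one_matrix_tuples_def by blast
  define Z where "Z t = (1 - t) \<cdot>\<^sub>m X + t \<cdot>\<^sub>m Y" for t
  define r where "r t = map2 (\<lambda>p q. Polynomial.smult (1 - t) p + Polynomial.smult t q) ps qs" for t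
  define G where "G t = map (\<lambda>p. poly_mat p (Z t)) (r t)" for t
  have Z: "Z t \<in> carrier_mat n n" for t using X(1) Y(1) by (simp add: Z_def)
  have len: "length (r t) = d" for t using X(2) Y(2) by (simp add: r_def)
  have "G t \<in> one_matrix_tuples d n" for t
    unfolding one_matrix_tuples_def G_def using Z len by blast
  moreover have "Z 0 = X" "Z 1 = Y"
    unfolding Z_def using X(1) Y(1) by (auto intro!: eq_matI)
  moreover have "r 0 = ps" "r 1 = qs"
    unfolding r_def using X(2) Y(2) by (auto intro!: nth_equalityI)
  moreover have "(\<lambda>t. G t ! k) \<in> polyfun.mat_fun n n" if "k < d" for k
  proof -
    have lin: "(\<lambda>t. 1 - t :: 'a) \<in> range poly" "(\<lambda>t. t :: 'a) \<in> range poly"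
    proof -
      show "(\<lambda>t. 1 - t :: 'a) \<in> range poly" by (rule range_eqI[of _ _ "[:1, -1:]"]) auto
      show "(\<lambda>t. t :: 'a) \<in> range poly" by (rule range_eqI[of _ _ "[:0, 1:]"]) auto
    qed
    have Zf: "Z \<in> polyfun.mat_fun n n"
      unfolding Z_def by (intro polyfun.mat_fun_add polyfun.mat_fun_smult lin polyfun.mat_fun_const X Y)
    have "(\<lambda>t. (1 - t) \<cdot>\<^sub>m poly_mat (ps ! k) (Z t) + t \<cdot>\<^sub>m poly_mat (qs ! k) (Z t)) \<in> polyfun.mat_fun n n"
      by (intro polyfun.mat_fun_add polyfun.mat_fun_smult lin polyfun.mat_fun_poly_mat Zf)
    moreover have "G t ! k = (1 - t) \<cdot>\<^sub>m poly_mat (ps ! k) (Z t) + t \<cdot>\<^sub>m poly_mat (qs ! k) (Z t)" for t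
      using that X(2) Y(2) by (simp add: G_def r_def poly_mat_add[OF Z] poly_mat_smult[OF Z])
    ultimately show ?thesis by simp
  qed
  ultimately show ?thesis
    using X(3) Y(3) by (intro exI[of _ G]) (simp add: G_def)
qed

lemma vanishes_on_factor_one_matrix_tuples:
  fixes p q :: "(nat \<times> nat \<times> nat, 'a::alg_closed_field) mpolynomial"
  assumes "p \<in> mpolys_in (entry_vars d n)" "q \<in> mpolys_in (entry_vars d n)"
    and "vanishes_on (p * q) (one_matrix_tuples d n)"
  shows "vanishes_on p (one_matrix_tuples d n) \<or> vanishes_on q (one_matrix_tuples d n)"
  by (rule vanishes_on_factor_if_curves[OF infinite_alg_closed_field one_matrix_tuples_curve assms])

section \<open>Nilpotent tuples lie in the closure\<close>

text \<open>If p vanishes on R and q vanishes wherever the first matrix has zero (n-1)-st power,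
  then p q vanishes on the whole nilpotent variety. Primality removes q as soon as q is nonzero at
  one point.\<close>

lemma nilpotent_commuting_subset_hull:
  assumes irr: "zariski_irreducible d n
      (nilpotent_commuting_variety d n :: 'a::alg_closed_field mat list set)"
    and "d > 0" "n > 0"
  shows "(nilpotent_commuting_variety d n :: 'a mat list set) \<subseteq> zariski_hull d n (one_matrix_tuples d n)"
proof -
  let ?N = "nilpotent_commuting_variety d n :: 'a mat list set"
  let ?R = "one_matrix_tuples d n :: 'a mat list set"
  have sub: "?N \<subseteq> mat_tuples d n"
    by (auto simp: nilpotent_commuting_variety_def commuting_variety_def)
  have "(\<lambda>As :: 'a mat list. As ! 0 ^\<^sub>m (n - 1)) \<in> regular.mat_fun d n n n"
    by (rule regular.mat_fun_pow[OF regular_nth[OF \<open>d > 0\<close>]])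
  \<comment> \<open>The top right corner is where the (n-1)-st power of a nilpotent Jordan block has
    its single entry 1, so this one polynomial serves as q.\<close>
  then have "(\<lambda>As. (As ! 0 ^\<^sub>m (n - 1)) $$ (0, n - 1)) \<in> (regular_functions d n :: ('a mat list \<Rightarrow> 'a) set)"
    using \<open>n > 0\<close> unfolding regular.mat_fun_def by auto
  then obtain q where q: "q \<in> mpolys_in (entry_vars d n)"
    "\<And>As :: 'a mat list. As \<in> mat_tuples d n \<Longrightarrow>
      (As ! 0 ^\<^sub>m (n - 1)) $$ (0, n - 1) = mpoly_eval q (entries As)"
    unfolding regular_functions_def by blast
  \<comment> \<open>The point where q is nonzero: a full Jordan block, padded with zero matrices,
    which commute with it.\<close>
  define J where "J = jordan_block n (0 :: 'a) # replicate (d - 1) (0\<^sub>m n n)"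
  have Jset: "set J \<subseteq> {jordan_block n 0, 0\<^sub>m n n}" by (auto simp: J_def)
  have "J \<in> ?N"
  proof -
    have "nilpotent_mat (jordan_block n (0 :: 'a))"
      unfolding nilpotent_mat_def by (auto simp: jordan_block_zero_pow intro!: exI[of _ n] eq_matI)
    moreover have "nilpotent_mat (0\<^sub>m n n :: 'a mat)"
      unfolding nilpotent_mat_def by (auto intro!: exI[of _ 1])
    moreover have z: "jordan_block n 0 * 0\<^sub>m n n = (0\<^sub>m n n :: 'a mat)" "0\<^sub>m n n * jordan_block n 0 = (0\<^sub>m n n :: 'a mat)"
      by (rule right_mult_zero_mat[OF jordan_block_carrier], rule left_mult_zero_mat[OF jordan_block_carrier])
    moreover have "length J = d" using \<open>d > 0\<close> by (simp add: J_def)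
    moreover have "set J \<subseteq> carrier_mat n n" using Jset by auto
    moreover have "A * B = B * A" if "A \<in> set J" "B \<in> set J" for A B
    proof -
      have "A = jordan_block n 0 \<or> A = 0\<^sub>m n n" "B = jordan_block n 0 \<or> B = 0\<^sub>m n n"
        using that Jset by auto
      then show ?thesis using z by (elim disjE) simp_all
    qed
    ultimately show ?thesis
      unfolding nilpotent_commuting_variety_def commuting_variety_def mat_tuples_def
      using Jset by auto
  qed
  moreover have "mpoly_eval q (entries J) = 1"
    using q(2)[of J] sub \<open>J \<in> ?N\<close> \<open>n > 0\<close> by (auto simp: J_def jordan_block_zero_pow)
  ultimately have nq: "\<not> vanishes_on q ?N" by (force simp: vanishes_on_def)
  have in_R: "As \<in> ?R" if As: "As \<in> ?N" and top: "As ! 0 ^\<^sub>m (n - 1) \<noteq> 0\<^sub>m n n" for As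
  proof -
    let ?A = "As ! 0"
    have A: "?A \<in> set As" using As \<open>d > 0\<close> sub by (auto simp: mat_tuples_def)
    have car: "B \<in> carrier_mat n n" if "B \<in> set As" for B
      using As sub that by (auto simp: mat_tuples_def)
    obtain l where l: "?A ^\<^sub>m l = 0\<^sub>m n n"
      using As A car[OF A] by (auto simp: nilpotent_commuting_variety_def nilpotent_mat_def)
    have "\<exists>p. B = poly_mat p ?A" if B: "B \<in> set As" for B
    proof -
      have "B * ?A = ?A * B"
        using As A B by (auto simp: nilpotent_commuting_variety_def commuting_variety_def)
      with poly_mat_of_commute[OF car[OF A] l top car[OF B]] show ?thesis by blast
    qed
    then obtain P where P: "\<And>B. B \<in> set As \<Longrightarrow> B = poly_mat (P B) ?A" by metis
    have "As = map (\<lambda>p. poly_mat p ?A) (map P As)"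
      unfolding map_map using P by (intro nth_equalityI) auto
    moreover have "length (map P As) = d" using As sub by (auto simp: mat_tuples_def)
    ultimately show ?thesis
      unfolding one_matrix_tuples_def using car[OF A] by blast
  qed
  have "vanishes_on p ?N" if p: "p \<in> mpolys_in (entry_vars d n)" "vanishes_on p ?R" for p
  proof -
    have "vanishes_on (p * q) ?N"
      unfolding vanishes_on_def
    proof
      fix As assume As: "As \<in> ?N"
      show "mpoly_eval (p * q) (entries As) = 0"
      proof (cases "As ! 0 ^\<^sub>m (n - 1) = 0\<^sub>m n n")
        case True
        then have "mpoly_eval q (entries As) = 0"
          using q(2)[of As] sub As \<open>n > 0\<close> by auto
        then show ?thesis by (simp add: mpoly_eval_mult)
      next
        case False
        then have "mpoly_eval p (entries As) = 0"
          using in_R[OF As] p(2) by (simp add: vanishes_on_def)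
        then show ?thesis by (simp add: mpoly_eval_mult)
      qed
    qed
    then show ?thesis
      using irr[unfolded zariski_irreducible_iff[OF sub]] p(1) q(1) nq by blast
  qed
  then show ?thesis
    using sub unfolding zariski_hull_def vanishes_on_def by blast
qed

section \<open>Block decompositions\<close>

text \<open>Rebracketing that exposes the inner product \<open>V * W\<close>, which in the uses
  below collapses to 0 or 1 or to a commuting idempotent.\<close>

lemma mult_mat_assoc6:
  fixes U :: "'a::semiring_0 mat"
  assumes "U \<in> carrier_mat n1 n2" "X \<in> carrier_mat n2 n3" "V \<in> carrier_mat n3 n4"
    and "W \<in> carrier_mat n4 n5" "Y \<in> carrier_mat n5 n6" "Z \<in> carrier_mat n6 n7"
  shows "(U * X * V) * (W * Y * Z) = U * X * (V * W) * Y * Z"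
proof -
  have UX: "U * X \<in> carrier_mat n1 n3" and UXV: "U * X * V \<in> carrier_mat n1 n4"
    and WY: "W * Y \<in> carrier_mat n4 n6"
    using assms by auto
  show ?thesis
    by (simp only: assoc_mult_mat[OF UX assms(3,4), symmetric] assoc_mult_mat[OF UXV assms(4,5)]
        assoc_mult_mat[OF UXV WY assms(6)])
qed

lemma add_mat_right_cancel:
  fixes X :: "'a::ab_group_add mat"
  assumes "X \<in> carrier_mat n m" "Y \<in> carrier_mat n m" "Z \<in> carrier_mat n m" "X + Z = Y + Z"
  shows "X = Y"
proof (rule eq_matI)
  fix i j assume "i < dim_row Y" "j < dim_col Y"
  then have "(X + Z) $$ (i, j) = X $$ (i, j) + Z $$ (i, j)" "(Y + Z) $$ (i, j) = Y $$ (i, j) + Z $$ (i, j)"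
    using assms(1-3) by auto
  then show "X $$ (i, j) = Y $$ (i, j)" using assms(4) by simp
qed (use assms in auto)

text \<open>Multiplying the splitting of 1 by \<open>V\<close> on the left gives V = V + V U' V', so
  V U' V' = 0; multiplying by \<open>U'\<close> on the right removes \<open>V'\<close>.\<close>

lemma block_cross_zero:
  fixes U V U' V' :: "'a::comm_ring_1 mat"
  assumes U: "U \<in> carrier_mat n a" and V: "V \<in> carrier_mat a n"
    and U': "U' \<in> carrier_mat n b" and V': "V' \<in> carrier_mat b n"
    and VU: "V * U = 1\<^sub>m a" and VU': "V' * U' = 1\<^sub>m b"
    and split: "U * V + U' * V' = 1\<^sub>m n"
  shows "V * U' = 0\<^sub>m a b"
proof -
  have UV: "U * V \<in> carrier_mat n n" "U' * V' \<in> carrier_mat n n" using assms by auto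
  have VUV': "V * (U' * V') \<in> carrier_mat a n" using V UV(2) by simp
  have "V * (U' * V') + V * (U * V) = V * (U * V + U' * V')"
    using mult_add_distrib_mat[OF V UV] comm_add_mat[OF mult_carrier_mat[OF V UV(1)] VUV'] by simp
  also have "\<dots> = 0\<^sub>m a n + V * (U * V)"
    unfolding split assoc_mult_mat[OF V U V, symmetric] VU using V by simp
  finally have "V * (U' * V') = 0\<^sub>m a n"
    by (rule add_mat_right_cancel[OF VUV' zero_carrier_mat mult_carrier_mat[OF V UV(1)]])
  then have "V * (U' * V') * U' = 0\<^sub>m a b" using U' by simp
  also have "V * (U' * V') * U' = V * (U' * (V' * U'))"
    by (simp only: assoc_mult_mat[OF V UV(2) U'] assoc_mult_mat[OF U' V' U'])
  finally show ?thesis unfolding VU' using U' by simp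
qed

text \<open>The idempotent U V in the middle moves past A and is absorbed by \<open>V\<close>, since
  V U V = V.\<close>

lemma compress_mult:
  fixes U V :: "'a::comm_ring_1 mat"
  assumes U: "U \<in> carrier_mat n a" and V: "V \<in> carrier_mat a n" and VU: "V * U = 1\<^sub>m a"
    and A: "A \<in> carrier_mat n n" and B: "B \<in> carrier_mat n n"
    and comm: "A * (U * V) = (U * V) * A"
  shows "(V * A * U) * (V * B * U) = V * (A * B) * U"
proof -
  have UV: "U * V \<in> carrier_mat n n" using U V by simp
  have "V * A * (U * V) = V * (U * V) * A"
    by (simp only: assoc_mult_mat[OF V A UV] comm assoc_mult_mat[OF V UV A])
  also have "\<dots> = V * A"
    unfolding assoc_mult_mat[OF V U V, symmetric] VU using V by simp
  finally show ?thesis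
    by (simp only: mult_mat_assoc6[OF V A U V B U] assoc_mult_mat[OF V A B])
qed

text \<open>A direct sum decomposition of n-space into summands of dimensions \<open>a\<close> and
  \<open>b\<close>: \<open>U\<close> and \<open>U'\<close> are the inclusions, \<open>V\<close> and
  \<open>V'\<close> the projections.\<close>

locale block_split =
  fixes n a b :: nat and U V U' V' :: "'a::comm_ring_1 mat"
  assumes U: "U \<in> carrier_mat n a" and V: "V \<in> carrier_mat a n"
    and U': "U' \<in> carrier_mat n b" and V': "V' \<in> carrier_mat b n"
    and VU: "V * U = 1\<^sub>m a" and VU': "V' * U' = 1\<^sub>m b"
    and split: "U * V + U' * V' = 1\<^sub>m n"
begin

definition block :: "'a mat \<Rightarrow> 'a mat \<Rightarrow> 'a mat" where
  "block X Y = U * X * V + U' * Y * V'"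

lemma summand_carrier:
  "X \<in> carrier_mat a a \<Longrightarrow> U * X * V \<in> carrier_mat n n"
  "Y \<in> carrier_mat b b \<Longrightarrow> U' * Y * V' \<in> carrier_mat n n"
  using U V U' V' by auto

lemma block_carrier [simp, intro]:
  "X \<in> carrier_mat a a \<Longrightarrow> Y \<in> carrier_mat b b \<Longrightarrow> block X Y \<in> carrier_mat n n"
  unfolding block_def using summand_carrier by simp

lemma cross: "V * U' = 0\<^sub>m a b" "V' * U = 0\<^sub>m b a"
proof -
  show "V * U' = 0\<^sub>m a b" by (rule block_cross_zero[OF U V U' V' VU VU' split])
  have "U' * V' + U * V = 1\<^sub>m n"
    using split comm_add_mat[OF mult_carrier_mat[OF U V] mult_carrier_mat[OF U' V']] by simp
  then show "V' * U = 0\<^sub>m b a" by (rule block_cross_zero[OF U' V' U V VU' VU])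
qed

lemma block_mult:
  assumes X: "X \<in> carrier_mat a a" "X2 \<in> carrier_mat a a"
    and Y: "Y \<in> carrier_mat b b" "Y2 \<in> carrier_mat b b"
  shows "block X Y * block X2 Y2 = block (X * X2) (Y * Y2)"
proof -
  note c = summand_carrier(1)[OF X(1)] summand_carrier(2)[OF Y(1)]
    summand_carrier(1)[OF X(2)] summand_carrier(2)[OF Y(2)]
  have UX: "U * X \<in> carrier_mat n a" "U' * Y \<in> carrier_mat n b" using U U' X Y by auto
  have 1: "U * X * V * (U * X2 * V) = U * (X * X2) * V"
    unfolding mult_mat_assoc6[OF U X(1) V U X(2) V] VU right_mult_one_mat[OF UX(1)]
    by (simp only: assoc_mult_mat[OF U X])
  have 2: "U' * Y * V' * (U' * Y2 * V') = U' * (Y * Y2) * V'"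
    unfolding mult_mat_assoc6[OF U' Y(1) V' U' Y(2) V'] VU' right_mult_one_mat[OF UX(2)]
    by (simp only: assoc_mult_mat[OF U' Y])
  have 3: "U * X * V * (U' * Y2 * V') = 0\<^sub>m n n"
    unfolding mult_mat_assoc6[OF U X(1) V U' Y(2) V'] cross right_mult_zero_mat[OF UX(1)]
    by (simp only: left_mult_zero_mat[OF Y(2)] left_mult_zero_mat[OF V'])
  have 4: "U' * Y * V' * (U * X2 * V) = 0\<^sub>m n n"
    unfolding mult_mat_assoc6[OF U' Y(1) V' U X(2) V] cross right_mult_zero_mat[OF UX(2)]
    by (simp only: left_mult_zero_mat[OF X(2)] left_mult_zero_mat[OF V])
  have "block X Y * block X2 Y2 =
      U * X * V * block X2 Y2 + U' * Y * V' * block X2 Y2"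
    unfolding block_def[of X Y]
    by (rule add_mult_distrib_mat[OF c(1,2) block_carrier[OF X(2) Y(2)]])
  also have "U * X * V * block X2 Y2 = U * X * V * (U * X2 * V) + U * X * V * (U' * Y2 * V')"
    unfolding block_def by (rule mult_add_distrib_mat[OF c(1,3,4)])
  also have "U' * Y * V' * block X2 Y2 = U' * Y * V' * (U * X2 * V) + U' * Y * V' * (U' * Y2 * V')"
    unfolding block_def by (rule mult_add_distrib_mat[OF c(2,3,4)])
  finally show ?thesis
    unfolding 1 2 3 4 block_def
    using summand_carrier(1)[OF mult_carrier_mat[OF X]] summand_carrier(2)[OF mult_carrier_mat[OF Y]]
    by simp
qed

text \<open>The scalar part goes to c (U V + U' V'), which is c times the identity. With
  \<open>block_mult\<close> this gives the recursion step for polynomials of a block sum.\<close>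

lemma block_scalar_add:
  assumes X: "X \<in> carrier_mat a a" and Y: "Y \<in> carrier_mat b b"
  shows "block (c \<cdot>\<^sub>m 1\<^sub>m a + X) (c \<cdot>\<^sub>m 1\<^sub>m b + Y) = c \<cdot>\<^sub>m 1\<^sub>m n + block X Y"
proof -
  have *: "P * (c \<cdot>\<^sub>m 1\<^sub>m r + Z) * Q = c \<cdot>\<^sub>m (P * Q) + P * Z * Q"
    if P: "P \<in> carrier_mat n r" and Q: "Q \<in> carrier_mat r n" and Z: "Z \<in> carrier_mat r r"
    for P Q Z :: "'a mat" and r
  proof -
    have s: "c \<cdot>\<^sub>m 1\<^sub>m r \<in> carrier_mat r r" by simp
    have "P * (c \<cdot>\<^sub>m 1\<^sub>m r + Z) * Q = P * (c \<cdot>\<^sub>m 1\<^sub>m r) * Q + P * Z * Q"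
      unfolding mult_add_distrib_mat[OF P s Z]
      by (rule add_mult_distrib_mat[OF mult_carrier_mat[OF P s] mult_carrier_mat[OF P Z] Q])
    also have "P * (c \<cdot>\<^sub>m 1\<^sub>m r) = c \<cdot>\<^sub>m P"
      unfolding mult_smult_distrib[OF P one_carrier_mat] right_mult_one_mat[OF P] ..
    also have "c \<cdot>\<^sub>m P * Q = c \<cdot>\<^sub>m (P * Q)"
      by (rule mult_smult_assoc_mat[OF P Q])
    finally show ?thesis .
  qed
  have "block (c \<cdot>\<^sub>m 1\<^sub>m a + X) (c \<cdot>\<^sub>m 1\<^sub>m b + Y) =
      c \<cdot>\<^sub>m (U * V) + U * X * V + (c \<cdot>\<^sub>m (U' * V') + U' * Y * V')"
    unfolding block_def *[OF U V X] *[OF U' V' Y] ..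
  also have "\<dots> = c \<cdot>\<^sub>m (U * V + U' * V') + (U * X * V + U' * Y * V')"
    using U V U' V' by (intro eq_matI) (auto simp: algebra_simps simp del: index_mult_mat(1))
  finally show ?thesis unfolding split block_def .
qed

lemma poly_mat_block:
  assumes X: "X \<in> carrier_mat a a" and Y: "Y \<in> carrier_mat b b"
  shows "poly_mat p (block X Y) = block (poly_mat p X) (poly_mat p Y)"
proof (induction p)
  case 0
  have "block (0\<^sub>m a a) (0\<^sub>m b b) = 0\<^sub>m n n"
    unfolding block_def right_mult_zero_mat[OF U] right_mult_zero_mat[OF U']
      left_mult_zero_mat[OF V] left_mult_zero_mat[OF V'] by simp
  then show ?case using X Y by simp
next
  case (pCons c p)
  have pc: "poly_mat p X \<in> carrier_mat a a" "poly_mat p Y \<in> carrier_mat b b" using X Y by auto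
  show ?case
    unfolding poly_mat_pCons[OF X] poly_mat_pCons[OF Y] poly_mat_pCons[OF block_carrier[OF X Y]]
      pCons.IH block_mult[OF pc(1) X pc(2) Y]
    by (rule block_scalar_add[OF mult_carrier_mat[OF pc(1) X] mult_carrier_mat[OF pc(2) Y], symmetric])
qed

text \<open>A matrix commuting with both idempotents preserves the two summands, so it is the sum of
  its compressions.\<close>

lemma block_compress:
  assumes A: "A \<in> carrier_mat n n"
    and comm: "A * (U * V) = (U * V) * A" "A * (U' * V') = (U' * V') * A"
  shows "block (V * A * U) (V' * A * U') = A"
proof -
  have *: "P * (Q * A * P) * Q = A * (P * Q)"
    if P: "P \<in> carrier_mat n r" and Q: "Q \<in> carrier_mat r n" and QP: "Q * P = 1\<^sub>m r"
      and c: "A * (P * Q) = (P * Q) * A" for P Q :: "'a mat" and r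
  proof -
    have PQ: "P * Q \<in> carrier_mat n n" and QA: "Q * A \<in> carrier_mat r n" using P Q A by auto
    have "P * (Q * A * P) * Q = P * (Q * A) * (P * Q)"
      by (simp only: assoc_mult_mat[OF P QA P, symmetric] assoc_mult_mat[OF mult_carrier_mat[OF P QA] P Q])
    also have "P * (Q * A) = A * (P * Q)"
      by (simp only: assoc_mult_mat[OF P Q A, symmetric] c)
    also have "A * (P * Q) * (P * Q) = A * ((P * Q) * (P * Q))"
      by (rule assoc_mult_mat[OF A PQ PQ])
    also have "(P * Q) * (P * Q) = P * ((Q * P) * Q)"
      by (simp only: assoc_mult_mat[OF P Q PQ] assoc_mult_mat[OF Q P Q])
    finally show ?thesis unfolding QP using Q by simp
  qed
  have UV: "U * V \<in> carrier_mat n n" "U' * V' \<in> carrier_mat n n" using U V U' V' by auto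
  have "block (V * A * U) (V' * A * U') = A * (U * V) + A * (U' * V')"
    unfolding block_def *[OF U V VU comm(1)] *[OF U' V' VU' comm(2)] ..
  also have "\<dots> = A" using mult_add_distrib_mat[OF A UV] split A by simp
  finally show ?thesis .
qed

text \<open>The closure is taken in one argument at a time: for fixed second tuple in
  \<open>S'\<close> the map is regular in the first, and afterwards the first tuple may be fixed
  anywhere in the closure of \<open>S\<close>.\<close>

lemma block_hull:
  assumes S: "S \<subseteq> mat_tuples d a" and S': "S' \<subseteq> mat_tuples d b"
    and R: "\<And>As Bs. As \<in> S \<Longrightarrow> Bs \<in> S' \<Longrightarrow> map2 block As Bs \<in> zariski_hull d n R"
    and As: "As \<in> zariski_hull d a S" and Bs: "Bs \<in> zariski_hull d b S'"
  shows "map2 block As Bs \<in> zariski_hull d n R"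
proof -
  have lenA: "length As = d" and carA: "k < d \<Longrightarrow> As ! k \<in> carrier_mat a a" for k
    using As nth_mem[of k As] unfolding zariski_hull_def mat_tuples_def by auto
  have step: "map2 block As Bs \<in> zariski_hull d n R" if "Bs \<in> S'" for Bs
  proof (rule zariski_hull_image[OF _ _ S R As])
    have lenB: "length Bs = d" and carB: "k < d \<Longrightarrow> Bs ! k \<in> carrier_mat b b" for k
      using that S' nth_mem[of k Bs] unfolding mat_tuples_def by blast+
    show "(\<lambda>As. map2 block As Bs ! k) \<in> regular.mat_fun d a n n" if "k < d" for k
    proof (rule regular.mat_fun_cong)
      show "(\<lambda>As. block (As ! k) (Bs ! k)) \<in> regular.mat_fun d a n n"
        unfolding block_def using U V U' V' carB[OF that] that
        by (intro regular.mat_fun_add regular.mat_fun_mult[of _ _ _ _ a] regular_nth regular.mat_fun_const) auto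
      show "block (As ! k) (Bs ! k) = map2 block As Bs ! k" if "As \<in> mat_tuples d a" for As
        using that lenB \<open>k < d\<close> by (simp add: mat_tuples_def)
    qed
    show "length (map2 block As Bs) = d" if "As \<in> mat_tuples d a" for As
      using that lenB by (simp add: mat_tuples_def)
  qed (use that in auto)
  show ?thesis
  proof (rule zariski_hull_image[OF _ _ S' step Bs])
    show "(\<lambda>Bs. map2 block As Bs ! k) \<in> regular.mat_fun d b n n" if "k < d" for k
    proof (rule regular.mat_fun_cong)
      show "(\<lambda>Bs. block (As ! k) (Bs ! k)) \<in> regular.mat_fun d b n n"
        unfolding block_def using U V U' V' carA[OF that] that
        by (intro regular.mat_fun_add regular.mat_fun_mult[of _ _ _ _ b] regular_nth regular.mat_fun_const) auto
      show "block (As ! k) (Bs ! k) = map2 block As Bs ! k" if "Bs \<in> mat_tuples d b" for Bs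
        using that lenA \<open>k < d\<close> by (simp add: mat_tuples_def)
    qed
    show "length (map2 block As Bs) = d" if "Bs \<in> mat_tuples d b" for Bs
      using that lenA by (simp add: mat_tuples_def)
  qed auto
qed

end

lemma pcompose_prod_mset_linear:
  "pcompose (\<Prod>x\<in>#M. [:-x, 1:]) [:-t, 1:] = (\<Prod>x\<in>#M. [:-(x + t), 1:] :: 'a::comm_ring_1 poly)"
proof (induction M)
  case (add x M)
  have "pcompose [:-x, 1:] [:-t, 1:] = [:-(x + t), 1:]" by (simp add: pcompose_pCons)
  then show ?case
    by (simp only: image_mset_add_mset prod_mset.add_mset pcompose_mult add.IH)
qed simp

text \<open>Replacing \<open>X\<close> by \<open>X + t\<close> makes its annihilating polynomial coprime to that of \<open>Y\<close>, and the
  Chinese remainder theorem then gives one polynomial for both blocks.\<close>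

lemma block_one_matrix_tuples:
  fixes U :: "'a::alg_closed_field mat"
  assumes "block_split n a b U V U' V'"
    and As: "As \<in> one_matrix_tuples d a" and Bs: "Bs \<in> one_matrix_tuples d b"
  shows "map2 (block_split.block U V U' V') As Bs \<in> one_matrix_tuples d n"
proof -
  interpret block_split n a b U V U' V' by fact
  obtain X ps where X: "X \<in> carrier_mat a a" "length ps = d" "As = map (\<lambda>p. poly_mat p X) ps"
    using As unfolding one_matrix_tuples_def by blast
  obtain Y qs where Y: "Y \<in> carrier_mat b b" "length qs = d" "Bs = map (\<lambda>p. poly_mat p Y) qs"
    using Bs unfolding one_matrix_tuples_def by blast
  obtain M where M: "poly_mat (\<Prod>x\<in>#M. [:-x, 1:]) X = 0\<^sub>m a a"
    using ex_annihilating_linear_product[OF X(1)] by blast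
  obtain N where N: "poly_mat (\<Prod>x\<in>#N. [:-x, 1:]) Y = 0\<^sub>m b b"
    using ex_annihilating_linear_product[OF Y(1)] by blast
  have "finite ((\<lambda>(x, y). y - x) ` (set_mset M \<times> set_mset N))" by simp
  \<comment> \<open>Only finitely many shifts, the differences of roots, would make a root of the
    shifted X meet a root of Y.\<close>
  from ex_new_if_finite[OF infinite_alg_closed_field this] obtain t
    where t: "t \<notin> (\<lambda>(x, y). y - x) ` (set_mset M \<times> set_mset N)" by blast
  have neq: "x + t \<noteq> y" if "x \<in># M" "y \<in># N" for x y
  proof
    assume "x + t = y"
    then have "t = y - x" by (simp add: algebra_simps)
    then show False using t that by (auto intro!: image_eqI[of _ _ "(x, y)"])
  qed
  define s where "s = [:-t, 1:]"
  \<comment> \<open>Since s = X - t undoes the shift, substituting it turns an annihilator of the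
    old matrix into one of \<open>X'\<close>, with all roots moved by \<open>t\<close>.\<close>
  define u where "u = pcompose (\<Prod>x\<in>#M. [:-x, 1:]) s"
  define v where "v = (\<Prod>y\<in>#N. [:-y, 1:])"
  define X' where "X' = poly_mat [:t, 1:] X"
  have X': "X' \<in> carrier_mat a a" using X(1) by (simp add: X'_def)
  have "pcompose s [:t, 1:] = [:0, 1:]" by (simp add: s_def pcompose_pCons)
  then have "poly_mat s X' = X"
    unfolding X'_def poly_mat_pcompose[OF X(1), symmetric]
    using X(1) poly_mat_X_power[OF X(1), of 1] by simp
  then have shift: "poly_mat (pcompose p s) X' = poly_mat p X" for p
    by (simp add: poly_mat_pcompose[OF X'])
  have "comaximal u v"
    unfolding u_def v_def s_def pcompose_prod_mset_linear
    by (intro comaximal_prod_mset, rule comaximal_sym, intro comaximal_prod_mset,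
        rule comaximal_linear_poly) (use neq in auto)
  then obtain e f where ef: "e * u + f * v = 1"
    unfolding comaximal_def by blast
  have u0: "poly_mat (p * u) X' = 0\<^sub>m a a" for p
    unfolding poly_mat_mult[OF X'] using M shift X' by (simp add: u_def)
  have v0: "poly_mat (p * v) Y = 0\<^sub>m b b" for p
    unfolding poly_mat_mult[OF Y(1)] using N Y(1) by (simp add: v_def)
  \<comment> \<open>The Chinese remainder solution: f v is 1 modulo u and e u is 1 modulo v, so
    \<open>r p q\<close> acts as p on the first block, after undoing the shift, and as q on the
    second.\<close>
  define r where "r p q = pcompose p s * (f * v) + q * (e * u)" for p q
  have rX: "poly_mat (r p q) X' = poly_mat p X" for p q
  proof -
    have "r p q = pcompose p s * (e * u + f * v) + (q - pcompose p s) * e * u"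
      by (simp add: r_def algebra_simps)
    then show ?thesis using X(1) by (simp add: ef poly_mat_add[OF X'] u0 shift)
  qed
  have rY: "poly_mat (r p q) Y = poly_mat q Y" for p q
  proof -
    have "r p q = q * (e * u + f * v) + (pcompose p s - q) * f * v"
      by (simp add: r_def algebra_simps)
    then show ?thesis using Y(1) by (simp add: ef poly_mat_add[OF Y(1)] v0)
  qed
  have "map2 block As Bs = map (\<lambda>p. poly_mat p (block X' Y)) (map2 r ps qs)"
    using X(2,3) Y(2,3) by (intro nth_equalityI) (auto simp: poly_mat_block[OF X' Y(1)] rX rY)
  moreover have "length (map2 r ps qs) = d" using X(2) Y(2) by simp
  ultimately show ?thesis
    unfolding one_matrix_tuples_def using block_carrier[OF X' Y(1)] by blast
qed

section \<open>The commuting variety\<close>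

lemma commuting_variety_subset_mat_tuples: "commuting_variety d n \<subseteq> mat_tuples d n"
  by (auto simp: commuting_variety_def)

lemma nilpotent_matI: "A \<in> carrier_mat n n \<Longrightarrow> A ^\<^sub>m k = 0\<^sub>m n n \<Longrightarrow> nilpotent_mat A"
  by (auto simp: nilpotent_mat_def)

text \<open>Adding a scalar matrix to each member is a regular map, and it preserves R because the
  scalar can be absorbed into the constant term of the polynomial.\<close>

lemma hull_translate:
  fixes Bs :: "'a::comm_ring_1 mat list"
  assumes "Bs \<in> zariski_hull d n (one_matrix_tuples d n)"
  shows "map (\<lambda>k. Bs ! k + x k \<cdot>\<^sub>m 1\<^sub>m n) [0..<d] \<in> zariski_hull d n (one_matrix_tuples d n)"
proof (rule zariski_hull_image[OF _ _ one_matrix_tuples_subset_mat_tuples _ assms])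
  show "(\<lambda>Bs. map (\<lambda>k. Bs ! k + x k \<cdot>\<^sub>m 1\<^sub>m n) [0..<d] ! k) \<in> regular.mat_fun d n n n" if "k < d" for k
  proof -
    have "(\<lambda>Bs. Bs ! k + x k \<cdot>\<^sub>m 1\<^sub>m n) \<in> regular.mat_fun d n n n"
      by (intro regular.mat_fun_add regular_nth that regular.mat_fun_const) simp
    then show ?thesis using that by simp
  qed
  show "map (\<lambda>k. Bs ! k + x k \<cdot>\<^sub>m 1\<^sub>m n) [0..<d] \<in> zariski_hull d n (one_matrix_tuples d n)"
    if Bs: "Bs \<in> one_matrix_tuples d n" for Bs :: "'a mat list"
  proof -
    obtain X ps where X: "X \<in> carrier_mat n n" "length ps = d" "Bs = map (\<lambda>p. poly_mat p X) ps"
      using Bs unfolding one_matrix_tuples_def by blast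
    define qs where "qs = map (\<lambda>k. ps ! k + [:x k:]) [0..<d]"
    have const: "poly_mat [:c:] X = c \<cdot>\<^sub>m 1\<^sub>m n" for c
      using X(1) by (intro eq_matI) (auto simp: poly_mat_pCons)
    have "map (\<lambda>k. Bs ! k + x k \<cdot>\<^sub>m 1\<^sub>m n) [0..<d] = map (\<lambda>p. poly_mat p X) qs"
      using X(2,3) by (intro nth_equalityI) (auto simp: qs_def poly_mat_add[OF X(1)] const)
    moreover have "length qs = d" by (simp add: qs_def)
    ultimately have "map (\<lambda>k. Bs ! k + x k \<cdot>\<^sub>m 1\<^sub>m n) [0..<d] \<in> one_matrix_tuples d n"
      unfolding one_matrix_tuples_def using X(1) by blast
    then show ?thesis
      using zariski_hull_superset[OF one_matrix_tuples_subset_mat_tuples] by blast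
  qed
qed simp

lemma compress_commuting_variety:
  fixes U V :: "'a::comm_ring_1 mat"
  assumes U: "U \<in> carrier_mat n a" and V: "V \<in> carrier_mat a n" and VU: "V * U = 1\<^sub>m a"
    and As: "As \<in> commuting_variety d n"
    and comm: "\<And>A. A \<in> set As \<Longrightarrow> A * (U * V) = (U * V) * A"
  shows "map (\<lambda>A. V * A * U) As \<in> commuting_variety d a"
proof -
  have car: "A \<in> carrier_mat n n" if "A \<in> set As" for A
    using As that by (auto simp: commuting_variety_def mat_tuples_def)
  have "(V * A * U) * (V * B * U) = (V * B * U) * (V * A * U)" if "A \<in> set As" "B \<in> set As" for A B
  proof -
    have "A * B = B * A" using As that by (simp add: commuting_variety_def)
    then show ?thesis
      using compress_mult[OF U V VU car[OF that(1)] car[OF that(2)] comm[OF that(1)]]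
        compress_mult[OF U V VU car[OF that(2)] car[OF that(1)] comm[OF that(2)]] by simp
  qed
  moreover have "V * A * U \<in> carrier_mat a a" if "A \<in> set As" for A
    using U V car[OF that] by simp
  ultimately show ?thesis
    using As by (auto simp: commuting_variety_def mat_tuples_def)
qed

text \<open>Excludes empty blocks: a nonzero idempotent cannot factor through dimension 0.\<close>

lemma mult_inner_dim_0:
  "U \<in> carrier_mat n 0 \<Longrightarrow> V \<in> carrier_mat 0 m \<Longrightarrow> U * V = (0\<^sub>m n m :: 'a::semiring_0 mat)"
  by (rule eq_matI) (auto simp: scalar_prod_def)

lemma commuting_variety_subset_hull:
  assumes irr: "\<And>m. 0 < m \<Longrightarrow> m \<le> n \<Longrightarrow>
      zariski_irreducible d m (nilpotent_commuting_variety d m :: 'a::alg_closed_field mat list set)"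
    and "d > 0" "m > 0" "m \<le> n"
  shows "(commuting_variety d m :: 'a mat list set) \<subseteq> zariski_hull d m (one_matrix_tuples d m)"
  using \<open>m > 0\<close> \<open>m \<le> n\<close>
proof (induction m rule: less_induct)
  case (less m)
  show ?case
  proof
    fix As :: "'a mat list" assume As: "As \<in> commuting_variety d m"
    have len: "length As = d" using As by (auto simp: commuting_variety_def mat_tuples_def)
    have car: "A \<in> carrier_mat m m" if "A \<in> set As" for A
      using As that by (auto simp: commuting_variety_def mat_tuples_def)
    have comm: "A * B = B * A" if "A \<in> set As" "B \<in> set As" for A B
      using As that by (simp add: commuting_variety_def)
    show "As \<in> zariski_hull d m (one_matrix_tuples d m)"
    proof (cases "\<forall>A\<in>set As. \<exists>x k. poly_mat [:-x, 1:] A ^\<^sub>m k = 0\<^sub>m m m")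
      case True
      \<comment> \<open>Each member has its own eigenvalue; subtracting it leaves a commuting
        nilpotent tuple.\<close>
      then obtain x where x: "\<And>A. A \<in> set As \<Longrightarrow> \<exists>k. poly_mat [:- x A, 1:] A ^\<^sub>m k = 0\<^sub>m m m"
        by metis
      define Bs where "Bs = map (\<lambda>A. poly_mat [:- x A, 1:] A) As"
      have "Bs \<in> nilpotent_commuting_variety d m"
      proof -
        have "poly_mat [:- x A, 1:] A * poly_mat [:- x B, 1:] B = poly_mat [:- x B, 1:] B * poly_mat [:- x A, 1:] A"
          if "A \<in> set As" "B \<in> set As" for A B
        proof (rule poly_mat_commute)
          show "poly_mat [:- x A, 1:] A * B = B * poly_mat [:- x A, 1:] A"
            by (rule poly_mat_commute[symmetric]) (use that car comm in auto)
        qed (use that car in auto)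
        moreover have "nilpotent_mat (poly_mat [:- x A, 1:] A)" if "A \<in> set As" for A
          using x[OF that] nilpotent_matI[OF poly_mat_carrier[OF car[OF that]]] by blast
        ultimately show ?thesis
          using len car by (auto simp: Bs_def nilpotent_commuting_variety_def commuting_variety_def mat_tuples_def)
      qed
      then have "Bs \<in> zariski_hull d m (one_matrix_tuples d m)"
        using nilpotent_commuting_subset_hull[OF irr \<open>d > 0\<close>] less.prems by blast
      then have "map (\<lambda>k. Bs ! k + x (As ! k) \<cdot>\<^sub>m 1\<^sub>m m) [0..<d] \<in> zariski_hull d m (one_matrix_tuples d m)"
        by (rule hull_translate)
      also have "map (\<lambda>k. Bs ! k + x (As ! k) \<cdot>\<^sub>m 1\<^sub>m m) [0..<d] = As"
      proof (rule nth_equalityI)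
        fix k assume "k < length (map (\<lambda>k. Bs ! k + x (As ! k) \<cdot>\<^sub>m 1\<^sub>m m) [0..<d])"
        then have k: "k < d" by simp
        have A: "As ! k \<in> carrier_mat m m" using k len car by simp
        have "poly_mat [:- x (As ! k), 1:] (As ! k) + x (As ! k) \<cdot>\<^sub>m 1\<^sub>m m = As ! k"
          unfolding poly_mat_linear[OF A] using A by (intro eq_matI) auto
        then show "map (\<lambda>k. Bs ! k + x (As ! k) \<cdot>\<^sub>m 1\<^sub>m m) [0..<d] ! k = As ! k"
          using k len by (simp add: Bs_def)
      qed (simp add: len)
      finally show ?thesis .
    next
      case False
      then obtain A p where A: "A \<in> set As" and idem: "poly_mat p A * poly_mat p A = poly_mat p A"
        and p: "poly_mat p A \<noteq> 0\<^sub>m m m" "poly_mat p A \<noteq> 1\<^sub>m m"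
        using nilpotent_or_idempotent[OF car] by blast
      define E F where "E = poly_mat p A" and "F = poly_mat (1 - p) A"
      have E: "E \<in> carrier_mat m m" and F: "F \<in> carrier_mat m m"
        using car[OF A] by (simp_all add: E_def F_def)
      have EF: "E + F = 1\<^sub>m m"
        using poly_mat_add[OF car[OF A], of p "1 - p"] car[OF A] by (simp add: E_def F_def)
      \<comment> \<open>From (1 - p)^2 + p = (1 - p) + p^2, written without subtraction of matrices;
        cancelling E = E E shows that F is idempotent.\<close>
      have "F * F + E = F + E * E"
      proof -
        have "poly_mat ((1 - p) * (1 - p) + p) A = poly_mat ((1 - p) + p * p) A"
          by (rule arg_cong[of _ _ "\<lambda>q. poly_mat q A"]) (simp add: algebra_simps)
        then show ?thesis
          by (simp only: poly_mat_add[OF car[OF A]] poly_mat_mult[OF car[OF A]] E_def F_def)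
      qed
      then have F_idem: "F * F = F"
        using add_mat_right_cancel[OF _ F E] F idem by (simp add: E_def)
      obtain a U V where U: "U \<in> carrier_mat m a" and V: "V \<in> carrier_mat a m" and EUV: "E = U * V"
        and VU: "V * U = 1\<^sub>m a" and "E \<noteq> 1\<^sub>m m \<Longrightarrow> a < m"
        using idempotent_rank_factorization[OF E] idem by (metis E_def)
      then have "a < m" using p(2) by (simp add: E_def)
      obtain b U' V' where U': "U' \<in> carrier_mat m b" and V': "V' \<in> carrier_mat b m"
        and FUV: "F = U' * V'" and VU': "V' * U' = 1\<^sub>m b" and b: "F \<noteq> 1\<^sub>m m \<Longrightarrow> b < m"
        using idempotent_rank_factorization[OF F F_idem] by metis
      have "F \<noteq> 1\<^sub>m m"
      proof
        assume "F = 1\<^sub>m m"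
        then have "E + F = 0\<^sub>m m m + F" using EF by simp
        then show False using add_mat_right_cancel[OF E _ F] p(1) by (simp add: E_def)
      qed
      then have "b < m" by (rule b)
      \<comment> \<open>The induction hypothesis covers only positive sizes below m. Nontriviality
        of E gives this for \<open>a\<close> and, through F = 1 - E, for \<open>b\<close>.\<close>
      have "a > 0"
        using mult_inner_dim_0[of U m V m] U V EUV p(1) by (cases "a = 0") (auto simp: E_def)
      have "b > 0"
      proof (rule ccontr)
        assume "\<not> b > 0"
        then have "F = 0\<^sub>m m m" using mult_inner_dim_0[of U' m V' m] U' V' FUV by simp
        then show False using EF E p(2) by (simp add: E_def)
      qed
      interpret block_split m a b U V U' V'
        using U V U' V' VU VU' EF by unfold_locales (simp_all add: EUV FUV)
      \<comment> \<open>Both idempotents are polynomials in a member of the tuple, so the whole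
        tuple commutes with them and compresses to two commuting tuples.\<close>
      have comm_poly: "B * poly_mat q A = poly_mat q A * B" if "B \<in> set As" for B q
        by (rule poly_mat_commute[OF car[OF A] car[OF that] comm[OF that A]])
      have commE: "B * (U * V) = (U * V) * B" and commF: "B * (U' * V') = (U' * V') * B"
        if "B \<in> set As" for B
        using comm_poly[OF that, of p] comm_poly[OF that, of "1 - p"] EUV FUV by (simp_all add: E_def F_def)
      let ?As1 = "map (\<lambda>A. V * A * U) As" and ?As2 = "map (\<lambda>A. V' * A * U') As"
      have "?As1 \<in> zariski_hull d a (one_matrix_tuples d a)"
        using less.IH[OF \<open>a < m\<close> \<open>a > 0\<close>] \<open>a < m\<close> less.prems
          compress_commuting_variety[OF U V VU As commE] by auto
      moreover have "?As2 \<in> zariski_hull d b (one_matrix_tuples d b)"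
        using less.IH[OF \<open>b < m\<close> \<open>b > 0\<close>] \<open>b < m\<close> less.prems
          compress_commuting_variety[OF U' V' VU' As commF] by auto
      ultimately have "map2 block ?As1 ?As2 \<in> zariski_hull d m (one_matrix_tuples d m)"
      proof (rule block_hull[OF one_matrix_tuples_subset_mat_tuples one_matrix_tuples_subset_mat_tuples, rotated 1])
        fix Bs Cs :: "'a mat list" assume "Bs \<in> one_matrix_tuples d a" "Cs \<in> one_matrix_tuples d b"
        from block_one_matrix_tuples[OF block_split_axioms this]
        show "map2 block Bs Cs \<in> zariski_hull d m (one_matrix_tuples d m)"
          using zariski_hull_superset[OF one_matrix_tuples_subset_mat_tuples] by blast
      qed
      also have "map2 block ?As1 ?As2 = As"
        using block_compress[OF car commE commF] by (intro nth_equalityI) auto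
      finally show ?thesis .
    qed
  qed
qed

theorem corollary4:
  fixes d n :: nat
  assumes "d > 0" and "n > 0"
    and "\<And>m. 0 < m \<Longrightarrow> m \<le> n \<Longrightarrow>
      zariski_irreducible d m
        (nilpotent_commuting_variety d m :: 'a::alg_closed_field mat list set)"
  shows "zariski_irreducible d n (commuting_variety d n :: 'a mat list set)"
proof -
  let ?C = "commuting_variety d n :: 'a mat list set" and ?R = "one_matrix_tuples d n :: 'a mat list set"
  have hull: "?C \<subseteq> zariski_hull d n ?R"
    using commuting_variety_subset_hull[OF assms(3) \<open>d > 0\<close> \<open>n > 0\<close>] by blast
  \<comment> \<open>By density a polynomial vanishing on R vanishes on C(d,n), so primality carries
    over from the ideal of R.\<close>
  have vanish: "vanishes_on p ?C" if "p \<in> mpolys_in (entry_vars d n)" "vanishes_on p ?R" for p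
    using hull that unfolding zariski_hull_def vanishes_on_def by blast
  have "replicate d (0\<^sub>m n n) \<in> ?C"
    by (auto simp: commuting_variety_def mat_tuples_def)
  then have "?C \<noteq> {}" by blast
  moreover have "vanishes_on p ?C \<or> vanishes_on q ?C"
    if p: "p \<in> mpolys_in (entry_vars d n)" and q: "q \<in> mpolys_in (entry_vars d n)"
      and pq: "vanishes_on (p * q) ?C" for p q
  proof -
    have "vanishes_on (p * q) ?R"
      using pq one_matrix_tuples_subset unfolding vanishes_on_def by blast
    from vanishes_on_factor_one_matrix_tuples[OF p q this] show ?thesis
      using vanish p q by blast
  qed
  ultimately show ?thesis
    unfolding zariski_irreducible_iff[OF commuting_variety_subset_mat_tuples] by blast
qed

end
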